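(* Let $p\ge 0$ be an integer and let $K$ be a finite simplicial complex of dimension greater than $p$. Let $[\partial_{p+1}]$ be the matrix of the boundary operator $\partial_{p+1}\colon C_{p+1}(K)\to C_p(K)$ (integer coefficients) in the elementary chain bases. Then $[\partial_{p+1}]$ is totally unimodular if and only if the relative homology group $H_p(L,L_0)$ (with $\mathbb{Z}$ coefficients) is torsion-free for all pure subcomplexes $L_0$ and $L$ of $K$ of dimensions $p$ and $p+1$ respectively with $L_0\subset L$.
   Context: An integer matrix is totally unimodular if every square submatrix has determinant $0$, $1$ or $-1$. Each simplex of $K$ is given an arbitrary fixed orientation. $C_q(K)$ is the free abelian group of $q$-chains with $\mathbb{Z}$ coefficients; its elementary chain basis consists of the oriented $q$-simplices of $K$. The boundary operator is $\partial_q[v_0,\dots,v_q]=\sum_{i=0}^q(-1)^i[v_0,\dots,\widehat{v_i},\dots,v_q]$, and column $j$ of $[\partial_{p+1}]$ lists the coefficients of the boundary of the $j$-th oriented $(p+1)$-simplex in the basis of oriented $p$-simplices. A pure simplicial complex of dimension $q$ is a simplicial complex formed by a collection of $q$-simplices and their proper faces; a pure subcomplex is a subcomplex that is a pure simplicial complex. Relative chains are $C_q(L,L_0)=C_q(L)/C_q(L_0)$, with the induced boundary operators, and $H_p(L,L_0)$ is the resulting relative homology group. *)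

theory Defs
  imports
    "HOL-Algebra.Free_Abelian_Groups"
    "HOL-Combinatorics.Permutations"
    "Jordan_Normal_Form.Determinant"
    "Jordan_Normal_Form.DL_Submatrix"
begin

section \<open>Totally unimodular matrices\<close>

definition totally_unimodular :: "int mat \<Rightarrow> bool" where
  "totally_unimodular A \<longleftrightarrow>
     (\<forall>I J. I \<subseteq> {..<dim_row A} \<longrightarrow> J \<subseteq> {..<dim_col A} \<longrightarrow> card I = card J \<longrightarrow>
        det (submatrix A I J) \<in> {-1, 0, 1})"

section \<open>Finite simplicial complexes\<close>

text \<open>Complexes are abstract: a simplex is its set of vertices, and the empty simplex is
  not a member (so homology is unreduced).\<close>

definition finite_simplicial_complex :: "'v set set \<Rightarrow> bool" where
  "finite_simplicial_complex K \<longleftrightarrow>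
     finite K \<and> (\<forall>\<sigma>\<in>K. finite \<sigma> \<and> \<sigma> \<noteq> {}) \<and>
     (\<forall>\<sigma>\<in>K. \<forall>\<tau>. \<tau> \<subseteq> \<sigma> \<longrightarrow> \<tau> \<noteq> {} \<longrightarrow> \<tau> \<in> K)"

definition simplices :: "'v set set \<Rightarrow> nat \<Rightarrow> 'v set set" where
  "simplices K q = {\<sigma> \<in> K. card \<sigma> = Suc q}"

text \<open>The dimension of the empty complex is \<open>-1\<close>.\<close>

definition complex_dim :: "'v set set \<Rightarrow> int" where
  "complex_dim K = (if K = {} then -1 else Max ((\<lambda>\<sigma>. int (card \<sigma>) - 1) ` K))"

definition pure_complex :: "nat \<Rightarrow> 'v set set \<Rightarrow> bool" where
  "pure_complex q L \<longleftrightarrow>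
     finite_simplicial_complex L \<and> complex_dim L = int q \<and>
     (\<exists>S. (\<forall>\<sigma>\<in>S. card \<sigma> = Suc q) \<and> L = {\<tau>. \<tau> \<noteq> {} \<and> (\<exists>\<sigma>\<in>S. \<tau> \<subseteq> \<sigma>)})"

section \<open>Oriented simplices, chains and the boundary operator\<close>

text \<open>The fixed orientation of a simplex is recorded by a representative ordering of its
  vertices; orderings that differ by an even permutation represent the same orientation.\<close>

definition orientation_of :: "'v set set \<Rightarrow> ('v set \<Rightarrow> 'v list) \<Rightarrow> bool" where
  "orientation_of K \<omega> \<longleftrightarrow> (\<forall>\<sigma>\<in>K. distinct (\<omega> \<sigma>) \<and> set (\<omega> \<sigma>) = \<sigma>)"

definition same_orientation :: "'v list \<Rightarrow> 'v list \<Rightarrow> bool" where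
  "same_orientation vs ws \<longleftrightarrow>
     (\<exists>\<pi>. \<pi> permutes {..<length vs} \<and> evenperm \<pi> \<and> permute_list \<pi> vs = ws)"

text \<open>A \<open>q\<close>-chain is the family of its coefficients in the elementary chain basis:
  \<open>frag_of \<sigma>\<close> stands for the simplex \<open>\<sigma>\<close> with its fixed orientation.\<close>

definition chain_group :: "'v set set \<Rightarrow> nat \<Rightarrow> ('v set \<Rightarrow>\<^sub>0 int) monoid" where
  "chain_group K q = free_Abelian_group (simplices K q)"

text \<open>The chain \<open>[v\<^sub>0, \<dots>, v\<^sub>q]\<close> of an arbitrarily ordered simplex: the basis element or its
  negative.\<close>

definition oriented_simplex :: "('v set \<Rightarrow> 'v list) \<Rightarrow> 'v list \<Rightarrow> ('v set \<Rightarrow>\<^sub>0 int)" where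
  "oriented_simplex \<omega> vs =
     (if same_orientation (\<omega> (set vs)) vs then frag_of (set vs) else - frag_of (set vs))"

definition omit_vertex :: "nat \<Rightarrow> 'v list \<Rightarrow> 'v list" where
  "omit_vertex i vs = take i vs @ drop (Suc i) vs"

text \<open>In degree 0 the operator is zero. Since \<open>0 - 1 = 0\<close> on \<^typ>\<open>nat\<close>, below it is a map from
  0-chains to 0-chains rather than to the trivial group; its kernel is the same.\<close>

definition simplicial_boundary ::
    "('v set \<Rightarrow> 'v list) \<Rightarrow> nat \<Rightarrow> ('v set \<Rightarrow>\<^sub>0 int) \<Rightarrow> ('v set \<Rightarrow>\<^sub>0 int)" where
  "simplicial_boundary \<omega> q c =
     (if q = 0 then 0
      else frag_extend
        (\<lambda>\<sigma>. \<Sum>i\<le>q. frag_cmul ((-1) ^ i) (oriented_simplex \<omega> (omit_vertex i (\<omega> \<sigma>)))) c)"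

text \<open>The matrix of \<open>\<partial>\<^sub>q\<close>, for the enumerations \<open>faces\<close> of the \<open>(q-1)\<close>-simplices and \<open>cells\<close> of
  the \<open>q\<close>-simplices.\<close>

definition boundary_matrix ::
    "('v set \<Rightarrow> 'v list) \<Rightarrow> nat \<Rightarrow> 'v set list \<Rightarrow> 'v set list \<Rightarrow> int mat" where
  "boundary_matrix \<omega> q faces cells =
     mat (length faces) (length cells)
       (\<lambda>(i, j). Poly_Mapping.lookup (simplicial_boundary \<omega> q (frag_of (cells ! j))) (faces ! i))"

section \<open>Relative homology\<close>

definition rel_chain_group ::
    "'v set set \<Rightarrow> 'v set set \<Rightarrow> nat \<Rightarrow> ('v set \<Rightarrow>\<^sub>0 int) set monoid" where
  "rel_chain_group L L0 q = chain_group L q Mod carrier (chain_group L0 q)"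

text \<open>The value on a coset is the common class of the boundaries of its elements.\<close>

definition rel_boundary ::
    "('v set \<Rightarrow> 'v list) \<Rightarrow> 'v set set \<Rightarrow> 'v set set \<Rightarrow> nat \<Rightarrow>
     ('v set \<Rightarrow>\<^sub>0 int) set \<Rightarrow> ('v set \<Rightarrow>\<^sub>0 int) set" where
  "rel_boundary \<omega> L L0 q X =
     the_elem ((\<lambda>c. carrier (chain_group L0 (q - 1)) #>\<^bsub>chain_group L (q - 1)\<^esub>
                     simplicial_boundary \<omega> q c) ` X)"

definition rel_cycles ::
    "('v set \<Rightarrow> 'v list) \<Rightarrow> 'v set set \<Rightarrow> 'v set set \<Rightarrow> nat \<Rightarrow> ('v set \<Rightarrow>\<^sub>0 int) set set" where
  "rel_cycles \<omega> L L0 q =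
     kernel (rel_chain_group L L0 q) (rel_chain_group L L0 (q - 1)) (rel_boundary \<omega> L L0 q)"

definition rel_boundaries ::
    "('v set \<Rightarrow> 'v list) \<Rightarrow> 'v set set \<Rightarrow> 'v set set \<Rightarrow> nat \<Rightarrow> ('v set \<Rightarrow>\<^sub>0 int) set set" where
  "rel_boundaries \<omega> L L0 q =
     rel_boundary \<omega> L L0 (Suc q) ` carrier (rel_chain_group L L0 (Suc q))"

definition rel_homology_group ::
    "('v set \<Rightarrow> 'v list) \<Rightarrow> 'v set set \<Rightarrow> 'v set set \<Rightarrow> nat \<Rightarrow>
     ('v set \<Rightarrow>\<^sub>0 int) set set monoid" where
  "rel_homology_group \<omega> L L0 q =
     subgroup_generated (rel_chain_group L L0 q) (rel_cycles \<omega> L L0 q)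
       Mod rel_boundaries \<omega> L L0 q"

definition torsion_free :: "('a, 'b) monoid_scheme \<Rightarrow> bool" where
  "torsion_free G \<longleftrightarrow>
     (\<forall>x\<in>carrier G. \<forall>n::nat. n > 0 \<longrightarrow> x [^]\<^bsub>G\<^esub> n = \<one>\<^bsub>G\<^esub> \<longrightarrow> x = \<one>\<^bsub>G\<^esub>)"

end

theory Submission
  imports Defs
begin

text \<open>If every square submatrix has determinant \<open>0\<close> or \<open>\<plusminus>1\<close>, then by Cramer's rule an integer
  vector that lies in the rational image of a submatrix lies in its integral image, so the cokernels
  of all submatrices are torsion-free. Conversely, a square submatrix of \<open>\<partial>\<close> with rows \<open>I\<close>, columns
  \<open>J\<close> and nonzero determinant is the whole relative boundary matrix of \<open>(L, L\<^sub>0)\<close>, where \<open>L\<close> is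
  generated by \<open>J\<close> and \<open>L\<^sub>0\<close> by the \<open>p\<close>-simplices of \<open>L\<close> outside \<open>I\<close>. Its cokernel is finite, so
  torsion-freeness makes it surjective and its determinant \<open>\<plusminus>1\<close>. Purity of \<open>L\<^sub>0\<close> requires that
  some \<open>p\<close>-simplex of \<open>L\<close> lies outside \<open>I\<close>: otherwise a \<open>p\<close>-cocycle would be a nontrivial
  relation between the rows.\<close>

section \<open>Orientation signs\<close>

text \<open>Since orientations are arbitrary, the coefficients of the boundary carry signs that
  depend on the lists \<open>\<omega> \<sigma>\<close>. An auxiliary injective numbering
  \<open>h\<close> of the vertices isolates them: \<open>rank h \<sigma> v\<close> is the position
  of \<open>v\<close> in \<open>\<sigma>\<close> in increasing order, counted from 0, and up to one
  sign per basis simplex the coefficient at \<open>\<sigma> - {v}\<close> is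
  \<open>(-1) ^ rank h \<sigma> v\<close>. The vanishing of the double boundary and the cocycle
  condition then rest on the same cancellation between the two orders in which a pair of vertices
  can be deleted. On the algebraic side, a relative boundary matrix need be neither square nor of
  full rank, so Cramer's rule is applied to a nonzero minor of maximal order, on whose rows all
  others depend. The adjugate stands in for the inverse, which keeps everything integral. In the
  converse its columns exhibit the determinant times each row simplex as a relative boundary; this
  is the torsion that the hypothesis excludes.\<close>

definition rank :: "('v \<Rightarrow> nat) \<Rightarrow> 'v set \<Rightarrow> 'v \<Rightarrow> nat" where
  "rank h \<sigma> v = card {w \<in> \<sigma>. h w < h v}"

lemma rank_less_card:
  assumes "finite \<sigma>" "v \<in> \<sigma>"
  shows "rank h \<sigma> v < card \<sigma>"
  unfolding rank_def by (rule psubset_card_mono) (use assms in auto)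

lemma rank_less_iff:
  assumes "finite \<sigma>" "v \<in> \<sigma>" "w \<in> \<sigma>"
  shows "rank h \<sigma> v < rank h \<sigma> w \<longleftrightarrow> h v < h w"
proof
  assume "h v < h w"
  then show "rank h \<sigma> v < rank h \<sigma> w"
    unfolding rank_def by (intro psubset_card_mono) (use assms in auto)
next
  assume *: "rank h \<sigma> v < rank h \<sigma> w"
  show "h v < h w"
  proof (rule ccontr)
    assume "\<not> h v < h w"
    then have "rank h \<sigma> w \<le> rank h \<sigma> v"
      unfolding rank_def by (intro card_mono) (use assms in auto)
    with * show False by simp
  qed
qed

lemma rank_Diff:
  assumes "finite \<sigma>" "v \<in> \<sigma>"
  shows "rank h \<sigma> w = rank h (\<sigma> - {v}) w + (if h v < h w then 1 else 0)"
proof (cases "h v < h w")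
  case True
  then have "{x \<in> \<sigma>. h x < h w} = insert v {x \<in> \<sigma> - {v}. h x < h w}"
    using assms by auto
  then show ?thesis
    using True assms by (simp add: rank_def)
next
  case False
  then have "{x \<in> \<sigma>. h x < h w} = {x \<in> \<sigma> - {v}. h x < h w}"
    by auto
  then show ?thesis
    using False by (simp add: rank_def)
qed

text \<open>The sign of the permutation that sorts the list along \<open>h\<close>. Written as the determinant of its
  permutation matrix, it changes by the sign of a reordering (permuted rows), and the effect of
  omitting an entry is Laplace expansion.\<close>

definition list_sign :: "('v \<Rightarrow> nat) \<Rightarrow> 'v list \<Rightarrow> int" where
  "list_sign h vs =
     det (mat (length vs) (length vs) (\<lambda>(i, j). of_bool (rank h (set vs) (vs ! i) = j)))"

lemma list_sign_permute:
  assumes "\<pi> permutes {..<length vs}"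
  shows "list_sign h (permute_list \<pi> vs) = sign \<pi> * list_sign h vs"
proof -
  let ?n = "length vs"
  let ?A = "mat ?n ?n (\<lambda>(i, j). of_bool (rank h (set vs) (vs ! i) = j)) :: int mat"
  have "\<pi> permutes {0..<?n}"
    using assms by (simp add: lessThan_atLeast0)
  then have "det (mat ?n ?n (\<lambda>(i, j). ?A $$ (\<pi> i, j))) = sign \<pi> * det ?A"
    using det_permute_rows[of ?A ?n \<pi>] by simp
  moreover have "mat ?n ?n (\<lambda>(i, j). ?A $$ (\<pi> i, j)) =
      mat ?n ?n (\<lambda>(i, j). of_bool (rank h (set vs) (permute_list \<pi> vs ! i) = j))"
    using permutes_in_image[OF assms] by (intro eq_matI) (auto simp: permute_list_nth[OF assms])
  ultimately show ?thesis
    by (simp add: list_sign_def set_permute_list[OF assms])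
qed

lemma length_omit_vertex: "i < length vs \<Longrightarrow> length (omit_vertex i vs) = length vs - 1"
  by (simp add: omit_vertex_def)

lemma nth_omit_vertex:
  "i < length vs \<Longrightarrow> j < length vs - 1 \<Longrightarrow> omit_vertex i vs ! j = vs ! insert_index i j"
  by (auto simp: omit_vertex_def insert_index_def nth_append)

lemma distinct_omit_vertex: "distinct vs \<Longrightarrow> distinct (omit_vertex i vs)"
  unfolding omit_vertex_def
  by (simp add: set_take_disj_set_drop_if_distinct)

lemma set_omit_vertex:
  assumes "distinct vs" "i < length vs"
  shows "set (omit_vertex i vs) = set vs - {vs ! i}"
proof -
  have "vs = take i vs @ vs ! i # drop (Suc i) vs"
    using assms by (simp add: id_take_nth_drop)
  with assms show ?thesis
    unfolding omit_vertex_def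
    by (metis Diff_insert_absorb Un_insert_right distinct.simps(2) distinct_append
        list.simps(15) not_distinct_conv_prefix set_append Un_iff)
qed

lemma list_sign_omit:
  assumes "distinct vs" "inj_on h (set vs)" "i < length vs"
  shows "list_sign h vs = (-1) ^ (i + rank h (set vs) (vs ! i)) * list_sign h (omit_vertex i vs)"
proof -
  define n where "n = length vs"
  define A :: "int mat" where "A = mat n n (\<lambda>(i, j). of_bool (rank h (set vs) (vs ! i) = j))"
  define r where "r = rank h (set vs) (vs ! i)"
  have card: "card (set vs) = n"
    using assms by (simp add: distinct_card n_def)
  have i: "i < n" using assms by (simp add: n_def)
  have r: "r < n"
    using rank_less_card[of "set vs" "vs ! i" h] assms card by (simp add: r_def)
  have "det A = (\<Sum>j<n. A $$ (i, j) * cofactor A i j)"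
    by (rule laplace_expansion_row) (use assms in \<open>auto simp: A_def n_def\<close>)
  also have "\<dots> = (\<Sum>j<n. if j = r then cofactor A i r else 0)"
    by (rule sum.cong) (use i in \<open>auto simp: A_def r_def\<close>)
  also have "\<dots> = cofactor A i r"
    using r by simp
  finally have 1: "det A = (-1) ^ (i + r) * det (mat_delete A i r)"
    by (simp add: cofactor_def)
  \<comment> \<open>Deleting column \<open>r\<close> lowers the column indices above
    \<open>r\<close> by one. Removing \<open>vs ! i\<close> changes the ranks of the other vertices
    in the same way, so the remaining minor is again the matrix of a
    \<open>list_sign\<close>.\<close>
  have "mat_delete A i r = mat (n - 1) (n - 1)
      (\<lambda>(k, j). of_bool (rank h (set (omit_vertex i vs)) (omit_vertex i vs ! k) = j))"
  proof (rule eq_matI, goal_cases)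
    case (1 k j)
    then have kj: "k < n - 1" "j < n - 1" by auto
    define k' where "k' = insert_index i k"
    have k': "k' < n" "k' \<noteq> i"
      using kj i by (auto simp: k'_def insert_index_def)
    let ?v = "vs ! i" and ?w = "vs ! k'"
    have w: "?w \<noteq> ?v" "?w \<in> set vs" "?v \<in> set vs"
      using k' i assms by (auto simp: n_def nth_eq_iff_index_eq)
    then have hw: "h ?w \<noteq> h ?v"
      using assms(2) by (auto dest: inj_onD)
    have rk: "rank h (set vs) ?w = rank h (set vs - {?v}) ?w + (if h ?v < h ?w then 1 else 0)"
      by (rule rank_Diff) (use w in auto)
    have lt: "h ?v < h ?w \<longleftrightarrow> r < rank h (set vs) ?w" "h ?w < h ?v \<longleftrightarrow> rank h (set vs) ?w < r"
      using w by (auto simp: r_def rank_less_iff)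
    have "mat_delete A i r $$ (k, j) = A $$ (k', insert_index r j)"
      unfolding k'_def
      using mat_delete_index[of A "n - 1" i r k j] kj i r by (simp add: A_def)
    also have "\<dots> = of_bool (rank h (set vs) ?w = insert_index r j)"
      using k' kj r by (auto simp: A_def insert_index_def)
    also have "\<dots> = of_bool (rank h (set vs - {?v}) ?w = j)"
      using rk lt hw by (auto simp: insert_index_def split: if_splits)
    also have "?w = omit_vertex i vs ! k"
      using nth_omit_vertex[of i vs k] kj i by (simp add: k'_def n_def)
    finally show ?case
      using kj assms by (simp add: set_omit_vertex)
  qed (auto simp: A_def)
  with 1 show ?thesis
    using i by (simp add: list_sign_def A_def n_def r_def length_omit_vertex)
qed

text \<open>Omitting the first vertex changes the sign by a power of -1, whose square is 1. The
  square form cancels two occurrences of an orientation sign directly.\<close>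

lemma list_sign_square:
  assumes "distinct vs" "inj_on h (set vs)"
  shows "list_sign h vs * list_sign h vs = 1"
  using assms
proof (induction "length vs" arbitrary: vs)
  case 0
  then show ?case by (simp add: list_sign_def)
next
  case (Suc n)
  let ?us = "omit_vertex 0 vs"
  have "0 < length vs"
    using Suc(2) by linarith
  then have "n = length ?us" "distinct ?us" "set ?us \<subseteq> set vs"
    using Suc(2-4) set_omit_vertex[of vs 0] length_omit_vertex[of 0 vs]
    by (auto simp: distinct_omit_vertex)
  then have "list_sign h ?us * list_sign h ?us = 1"
    using Suc by (metis inj_on_subset)
  moreover obtain k where "list_sign h vs = (-1) ^ k * list_sign h ?us"
    using list_sign_omit[of vs h 0] Suc(3,4) \<open>0 < length vs\<close> by blast
  then have "list_sign h vs * list_sign h vs =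
      ((-1) ^ k * (-1) ^ k) * (list_sign h ?us * list_sign h ?us)"
    by (simp only: ac_simps)
  ultimately show ?case
    by simp
qed

text \<open>Some permutation carries \<open>us\<close> to \<open>vs\<close>, and its sign relates
  the two list signs. These are nonzero, so the permutation is even exactly when they agree.\<close>

lemma same_orientation_iff_list_sign:
  assumes "distinct us" "distinct vs" "set us = set vs" "inj_on h (set vs)"
  shows "same_orientation us vs \<longleftrightarrow> list_sign h us = list_sign h vs"
proof
  assume "same_orientation us vs"
  then show "list_sign h us = list_sign h vs"
    by (auto simp: same_orientation_def list_sign_permute sign_def)
next
  assume eq: "list_sign h us = list_sign h vs"
  have "mset vs = mset us"
    using assms by (simp add: set_eq_iff_mset_eq_distinct)
  then obtain \<pi> where \<pi>: "\<pi> permutes {..<length us}" "permute_list \<pi> us = vs"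
    by (rule mset_eq_permutation)
  have "list_sign h us \<noteq> 0"
    using list_sign_square[of us h] assms by auto
  then have "sign \<pi> = 1"
    using list_sign_permute[OF \<pi>(1), of h] \<pi> eq by simp
  then show "same_orientation us vs"
    using \<pi> by (auto simp: same_orientation_def sign_def split: if_splits)
qed

text \<open>Replaces the case distinction in \<open>oriented_simplex\<close> by a product of two
  signs, which can be multiplied and cancelled.\<close>

lemma oriented_simplex_list_sign:
  assumes "orientation_of K \<omega>" "set vs \<in> K" "distinct vs" "inj_on h (set vs)"
  shows "oriented_simplex \<omega> vs =
    frag_cmul (list_sign h (\<omega> (set vs)) * list_sign h vs) (frag_of (set vs))"
proof -
  have \<omega>: "distinct (\<omega> (set vs))" "set (\<omega> (set vs)) = set vs"
    using assms by (auto simp: orientation_of_def)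
  have "list_sign h vs = 1 \<or> list_sign h vs = -1"
    "list_sign h (\<omega> (set vs)) = 1 \<or> list_sign h (\<omega> (set vs)) = -1"
    using list_sign_square[of vs h] list_sign_square[of "\<omega> (set vs)" h] assms \<omega>
    by (auto simp: square_eq_1_iff)
  then show ?thesis
    unfolding oriented_simplex_def
    using same_orientation_iff_list_sign[of "\<omega> (set vs)" vs h] assms \<omega> by auto
qed

section \<open>The simplicial boundary\<close>

text \<open>Exchanging the two summations shows that the sum is its own negative.\<close>

lemma sum_antisymmetric_pairs:
  fixes f :: "'a \<Rightarrow> 'a \<Rightarrow> int"
  assumes "finite A" "\<And>x y. x \<in> A \<Longrightarrow> y \<in> A \<Longrightarrow> x \<noteq> y \<Longrightarrow> f x y = - f y x"
  shows "(\<Sum>x\<in>A. \<Sum>y\<in>A - {x}. f x y) = 0"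
proof -
  have eq: "{y \<in> A. y \<noteq> x} = A - {x}" "{y \<in> A. x \<noteq> y} = A - {x}" for x
    by auto
  have "(\<Sum>x\<in>A. \<Sum>y\<in>A - {x}. f x y) = (\<Sum>y\<in>A. \<Sum>x\<in>A - {y}. f x y)"
    using sum.swap_restrict[OF assms(1) assms(1), of f "\<lambda>x y. x \<noteq> y"] by (simp add: eq)
  also have "\<dots> = (\<Sum>y\<in>A. \<Sum>x\<in>A - {y}. - f y x)"
    by (intro sum.cong) (use assms(2) in auto)
  finally show ?thesis
    by (simp add: sum_negf)
qed

text \<open>Of two vertices exactly one precedes the other, so deleting them in the opposite order
  shifts the total rank by one and flips the sign, while the remaining face is the same. The weight
  \<open>\<phi>\<close> is arbitrary, which lets the lemma serve both the double boundary and the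
  cocycle.\<close>

lemma alternating_rank_sum_eq_0:
  fixes \<phi> :: "'v set \<Rightarrow> int"
  assumes "finite \<sigma>" "inj_on h \<sigma>"
  shows "(\<Sum>v\<in>\<sigma>. \<Sum>w\<in>\<sigma> - {v}. (-1) ^ (rank h \<sigma> v + rank h (\<sigma> - {v}) w) * \<phi> (\<sigma> - {v} - {w})) = 0"
proof (rule sum_antisymmetric_pairs)
  fix v w
  assume vw: "v \<in> \<sigma>" "w \<in> \<sigma>" "v \<noteq> w"
  then have "h v \<noteq> h w"
    using assms(2) by (auto dest: inj_onD)
  then have "rank h \<sigma> v + rank h (\<sigma> - {v}) w = Suc (rank h \<sigma> w + rank h (\<sigma> - {w}) v) \<or>
      Suc (rank h \<sigma> v + rank h (\<sigma> - {v}) w) = rank h \<sigma> w + rank h (\<sigma> - {w}) v"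
    using rank_Diff[OF assms(1) vw(1), of h w] rank_Diff[OF assms(1) vw(2), of h v]
    by (cases "h v < h w") simp_all
  then have "(-1 :: int) ^ (rank h \<sigma> v + rank h (\<sigma> - {v}) w) = - ((-1) ^ (rank h \<sigma> w + rank h (\<sigma> - {w}) v))"
  proof
    assume *: "Suc (rank h \<sigma> v + rank h (\<sigma> - {v}) w) = rank h \<sigma> w + rank h (\<sigma> - {w}) v"
    show ?thesis unfolding *[symmetric] by simp
  qed simp
  moreover have "\<sigma> - {v} - {w} = \<sigma> - {w} - {v}"
    by auto
  ultimately show "(-1) ^ (rank h \<sigma> v + rank h (\<sigma> - {v}) w) * \<phi> (\<sigma> - {v} - {w}) =
      - ((-1) ^ (rank h \<sigma> w + rank h (\<sigma> - {w}) v) * \<phi> (\<sigma> - {w} - {v}))"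
    by (simp only: mult_minus_left)
qed (use assms in simp)

text \<open>The incidence number of \<open>\<sigma>\<close> and its facet opposite \<open>v\<close>.
  The power of -1 is its value for the orientations increasing in \<open>h\<close>; the two list
  signs convert to the fixed orientations.\<close>

definition incidence :: "('v \<Rightarrow> nat) \<Rightarrow> ('v set \<Rightarrow> 'v list) \<Rightarrow> 'v set \<Rightarrow> 'v \<Rightarrow> int" where
  "incidence h \<omega> \<sigma> v = list_sign h (\<omega> \<sigma>) * list_sign h (\<omega> (\<sigma> - {v})) * (-1) ^ rank h \<sigma> v"

lemma simplicial_boundary_0 [simp]: "simplicial_boundary \<omega> q 0 = 0"
  by (simp add: simplicial_boundary_def)

lemma simplicial_boundary_add:
  "simplicial_boundary \<omega> q (c + d) = simplicial_boundary \<omega> q c + simplicial_boundary \<omega> q d"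
  by (simp add: simplicial_boundary_def frag_extend_add)

lemma simplicial_boundary_diff:
  "simplicial_boundary \<omega> q (c - d) = simplicial_boundary \<omega> q c - simplicial_boundary \<omega> q d"
  by (simp add: simplicial_boundary_def frag_extend_diff)

lemma simplicial_boundary_cmul:
  "simplicial_boundary \<omega> q (frag_cmul k c) = frag_cmul k (simplicial_boundary \<omega> q c)"
  by (simp add: simplicial_boundary_def frag_extend_cmul)

lemma simplicial_boundary_sum:
  "finite I \<Longrightarrow> simplicial_boundary \<omega> q (sum c I) = (\<Sum>i\<in>I. simplicial_boundary \<omega> q (c i))"
  by (simp add: simplicial_boundary_def frag_extend_sum)

section \<open>Boundaries and cocycles of an oriented complex\<close>

locale oriented_complex =
  fixes K :: "'v set set" and \<omega> :: "'v set \<Rightarrow> 'v list"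
  assumes K: "finite_simplicial_complex K" and \<omega>: "orientation_of K \<omega>"
begin

lemma finite_simplex: "\<sigma> \<in> K \<Longrightarrow> finite \<sigma>"
  using K unfolding finite_simplicial_complex_def by blast

lemma finite_complex: "finite K"
  using K unfolding finite_simplicial_complex_def by blast

lemma face_in_complex: "\<sigma> \<in> K \<Longrightarrow> \<tau> \<subseteq> \<sigma> \<Longrightarrow> \<tau> \<noteq> {} \<Longrightarrow> \<tau> \<in> K"
  using K unfolding finite_simplicial_complex_def by blast

lemma facet_in_simplices:
  assumes "\<sigma> \<in> simplices K (Suc q)" "v \<in> \<sigma>"
  shows "\<sigma> - {v} \<in> simplices K q"
proof -
  have "card (\<sigma> - {v}) = Suc q"
    using assms by (simp add: simplices_def)
  moreover have "\<sigma> - {v} \<noteq> {}"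
    using calculation by force
  ultimately show ?thesis
    using assms(1) face_in_complex[of \<sigma> "\<sigma> - {v}"] by (simp add: simplices_def)
qed

lemma orientation_simplex: "\<sigma> \<in> K \<Longrightarrow> distinct (\<omega> \<sigma>)" "\<sigma> \<in> K \<Longrightarrow> set (\<omega> \<sigma>) = \<sigma>"
  using \<omega> unfolding orientation_of_def by blast+

lemma inj_on_simplex: "inj_on h (\<Union>K) \<Longrightarrow> \<sigma> \<in> K \<Longrightarrow> inj_on h \<sigma>"
  by (erule inj_on_subset) auto

lemma list_sign_orientation_square:
  "inj_on h (\<Union>K) \<Longrightarrow> \<sigma> \<in> K \<Longrightarrow> list_sign h (\<omega> \<sigma>) * list_sign h (\<omega> \<sigma>) = 1"
  by (rule list_sign_square) (simp_all add: orientation_simplex inj_on_simplex)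

lemma obtain_vertex_numbering:
  obtains h :: "'v \<Rightarrow> nat" where "inj_on h (\<Union>K)"
proof -
  have "finite (\<Union>K)"
    using finite_complex finite_simplex by blast
  from finite_imp_inj_to_nat_seg[OF this] show ?thesis
    by (elim exE conjE) (rule that)
qed

text \<open>Reindexes the alternating sum by the omitted vertex. The position \<open>i\<close>
  disappears because \<open>list_sign_omit\<close> contributes the same power
  \<open>(-1) ^ i\<close> as the boundary formula, leaving only the rank of the vertex.\<close>

lemma boundary_frag_of:
  assumes h: "inj_on h (\<Union>K)" and \<sigma>: "\<sigma> \<in> simplices K (Suc q)"
  shows "simplicial_boundary \<omega> (Suc q) (frag_of \<sigma>) =
    (\<Sum>v\<in>\<sigma>. frag_cmul (incidence h \<omega> \<sigma> v) (frag_of (\<sigma> - {v})))"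
proof -
  let ?vs = "\<omega> \<sigma>"
  have \<sigma>K: "\<sigma> \<in> K" and vs: "distinct ?vs" "set ?vs = \<sigma>"
    using \<sigma> orientation_simplex by (auto simp: simplices_def)
  have len: "length ?vs = Suc (Suc q)"
    using vs \<sigma> by (metis (mono_tags) distinct_card mem_Collect_eq simplices_def)
  have inj: "inj_on h \<sigma>"
    using h \<sigma>K by (rule inj_on_simplex)
  have "frag_cmul ((-1) ^ i) (oriented_simplex \<omega> (omit_vertex i ?vs)) =
      frag_cmul (incidence h \<omega> \<sigma> (?vs ! i)) (frag_of (\<sigma> - {?vs ! i}))" if "i \<le> Suc q" for i
  proof -
    let ?us = "omit_vertex i ?vs" and ?v = "?vs ! i"
    have i: "i < length ?vs" using that len by simp
    have us: "set ?us = \<sigma> - {?v}" "distinct ?us"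
      using vs i by (auto simp: set_omit_vertex distinct_omit_vertex)
    have "\<sigma> - {?v} \<in> K"
      using facet_in_simplices[OF \<sigma>, of ?v] nth_mem[OF i] vs(2) by (auto simp: simplices_def)
    then have "oriented_simplex \<omega> ?us =
        frag_cmul (list_sign h (\<omega> (\<sigma> - {?v})) * list_sign h ?us) (frag_of (\<sigma> - {?v}))"
      using oriented_simplex_list_sign[OF \<omega>, of ?us h] us inj_on_simplex[OF h] by simp
    moreover have "list_sign h ?vs = (-1) ^ (i + rank h \<sigma> ?v) * list_sign h ?us"
      using list_sign_omit[of ?vs h i] vs inj i by simp
    ultimately show ?thesis
      by (simp add: incidence_def power_add algebra_simps)
  qed
  then have "simplicial_boundary \<omega> (Suc q) (frag_of \<sigma>) =
      (\<Sum>i\<le>Suc q. frag_cmul (incidence h \<omega> \<sigma> (?vs ! i)) (frag_of (\<sigma> - {?vs ! i})))"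
    unfolding simplicial_boundary_def by (simp del: sum.atMost_Suc power_Suc)
  also have "\<dots> = (\<Sum>v\<in>\<sigma>. frag_cmul (incidence h \<omega> \<sigma> v) (frag_of (\<sigma> - {v})))"
    by (rule sum.reindex_bij_betw[of "(!) ?vs" "{..Suc q}" \<sigma>])
      (use bij_betw_nth[of ?vs "{..<Suc (Suc q)}" \<sigma>] vs len in \<open>simp add: lessThan_Suc_atMost\<close>)
  finally show ?thesis .
qed

lemma lookup_boundary_frag_of:
  assumes "inj_on h (\<Union>K)" "\<sigma> \<in> simplices K (Suc q)"
  shows "Poly_Mapping.lookup (simplicial_boundary \<omega> (Suc q) (frag_of \<sigma>)) \<tau> =
    (\<Sum>v\<in>\<sigma>. incidence h \<omega> \<sigma> v * of_bool (\<tau> = \<sigma> - {v}))"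
  unfolding boundary_frag_of[OF assms] lookup_sum by (intro sum.cong) auto

lemma keys_boundary_frag_of:
  assumes "\<sigma> \<in> simplices K (Suc q)"
  shows "Poly_Mapping.keys (simplicial_boundary \<omega> (Suc q) (frag_of \<sigma>)) \<subseteq> (\<lambda>v. \<sigma> - {v}) ` \<sigma>"
proof -
  obtain h :: "'v \<Rightarrow> nat" where h: "inj_on h (\<Union>K)"
    by (rule obtain_vertex_numbering)
  show ?thesis
  proof
    fix \<tau>
    assume "\<tau> \<in> Poly_Mapping.keys (simplicial_boundary \<omega> (Suc q) (frag_of \<sigma>))"
    then have "(\<Sum>v\<in>\<sigma>. incidence h \<omega> \<sigma> v * of_bool (\<tau> = \<sigma> - {v})) \<noteq> 0"
      by (simp add: in_keys_iff lookup_boundary_frag_of[OF h assms])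
    then obtain v where "v \<in> \<sigma>" "incidence h \<omega> \<sigma> v * of_bool (\<tau> = \<sigma> - {v}) \<noteq> 0"
      by (rule sum.not_neutral_contains_not_neutral)
    then show "\<tau> \<in> (\<lambda>v. \<sigma> - {v}) ` \<sigma>"
      by (auto split: if_splits)
  qed
qed

text \<open>The orientation sign of the facet \<open>\<sigma> - {v}\<close> occurs twice and
  cancels, which leaves an alternating rank sum. The sign of the codimension-two face is left to
  \<open>\<phi>\<close>, since for an edge this face is empty and \<open>orientation_of\<close> says
  nothing about it.\<close>

lemma incidence_sum_eq_0:
  assumes h: "inj_on h (\<Union>K)" and \<sigma>: "\<sigma> \<in> simplices K (Suc q)"
  shows "(\<Sum>v\<in>\<sigma>. incidence h \<omega> \<sigma> v *
     (\<Sum>w\<in>\<sigma> - {v}. list_sign h (\<omega> (\<sigma> - {v})) * (-1) ^ rank h (\<sigma> - {v}) w * \<phi> (\<sigma> - {v} - {w}))) = 0"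
    (is "?lhs = 0")
proof -
  let ?\<psi> = "\<lambda>\<tau>. list_sign h (\<omega> \<sigma>) * \<phi> \<tau>"
  have \<sigma>K: "\<sigma> \<in> K" using \<sigma> by (simp add: simplices_def)
  have "?lhs = (\<Sum>v\<in>\<sigma>. \<Sum>w\<in>\<sigma> - {v}. (-1) ^ (rank h \<sigma> v + rank h (\<sigma> - {v}) w) * ?\<psi> (\<sigma> - {v} - {w}))"
  proof (intro sum.cong refl)
    fix v assume "v \<in> \<sigma>"
    then have "\<sigma> - {v} \<in> K"
      using facet_in_simplices[OF \<sigma>] by (auto simp: simplices_def)
    then have sq: "list_sign h (\<omega> (\<sigma> - {v})) * (list_sign h (\<omega> (\<sigma> - {v})) * x) = x" for x
      using list_sign_orientation_square[OF h] by (simp flip: mult.assoc)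
    show "incidence h \<omega> \<sigma> v *
     (\<Sum>w\<in>\<sigma> - {v}. list_sign h (\<omega> (\<sigma> - {v})) * (-1) ^ rank h (\<sigma> - {v}) w * \<phi> (\<sigma> - {v} - {w})) =
      (\<Sum>w\<in>\<sigma> - {v}. (-1) ^ (rank h \<sigma> v + rank h (\<sigma> - {v}) w) * ?\<psi> (\<sigma> - {v} - {w}))"
      unfolding sum_distrib_left
      by (intro sum.cong refl) (simp add: incidence_def power_add mult.left_commute mult.assoc sq)
  qed
  also have "\<dots> = 0"
    by (rule alternating_rank_sum_eq_0) (use \<sigma>K h in \<open>simp_all add: finite_simplex inj_on_simplex\<close>)
  finally show ?thesis .
qed

lemma boundary_boundary:
  assumes "Poly_Mapping.keys c \<subseteq> simplices K (Suc q)"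
  shows "simplicial_boundary \<omega> q (simplicial_boundary \<omega> (Suc q) c) = 0"
proof (cases q)
  case 0
  then show ?thesis by (simp add: simplicial_boundary_def)
next
  case (Suc r)
  obtain h :: "'v \<Rightarrow> nat" where h: "inj_on h (\<Union>K)"
    by (rule obtain_vertex_numbering)
  have "simplicial_boundary \<omega> q (simplicial_boundary \<omega> (Suc q) (frag_of \<sigma>)) = 0"
    if \<sigma>: "\<sigma> \<in> simplices K (Suc q)" for \<sigma>
  proof (rule poly_mapping_eqI)
    fix \<rho>
    have fin: "finite \<sigma>"
      using \<sigma> by (simp add: simplices_def finite_simplex)
    have "Poly_Mapping.lookup (simplicial_boundary \<omega> q (simplicial_boundary \<omega> (Suc q) (frag_of \<sigma>))) \<rho> =
      (\<Sum>v\<in>\<sigma>. incidence h \<omega> \<sigma> v * Poly_Mapping.lookup (simplicial_boundary \<omega> q (frag_of (\<sigma> - {v}))) \<rho>)"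
      using fin by (simp add: boundary_frag_of[OF h \<sigma>] simplicial_boundary_sum
          simplicial_boundary_cmul lookup_sum)
    also have "\<dots> = (\<Sum>v\<in>\<sigma>. incidence h \<omega> \<sigma> v *
       (\<Sum>w\<in>\<sigma> - {v}. list_sign h (\<omega> (\<sigma> - {v})) * (-1) ^ rank h (\<sigma> - {v}) w *
          (list_sign h (\<omega> (\<sigma> - {v} - {w})) * of_bool (\<rho> = \<sigma> - {v} - {w}))))"
    proof (intro sum.cong refl)
      fix v assume "v \<in> \<sigma>"
      then have "\<sigma> - {v} \<in> simplices K (Suc r)"
        using facet_in_simplices[OF \<sigma>] Suc by simp
      from lookup_boundary_frag_of[OF h this, of \<rho>]
      show "incidence h \<omega> \<sigma> v * Poly_Mapping.lookup (simplicial_boundary \<omega> q (frag_of (\<sigma> - {v}))) \<rho> =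
        incidence h \<omega> \<sigma> v *
       (\<Sum>w\<in>\<sigma> - {v}. list_sign h (\<omega> (\<sigma> - {v})) * (-1) ^ rank h (\<sigma> - {v}) w *
          (list_sign h (\<omega> (\<sigma> - {v} - {w})) * of_bool (\<rho> = \<sigma> - {v} - {w})))"
        unfolding Suc incidence_def by (simp add: mult_ac)
    qed
    also have "\<dots> = 0"
      using incidence_sum_eq_0[OF h \<sigma>, of "\<lambda>\<tau>. list_sign h (\<omega> \<tau>) * of_bool (\<rho> = \<tau>)"] .
    finally show "Poly_Mapping.lookup (simplicial_boundary \<omega> q (simplicial_boundary \<omega> (Suc q) (frag_of \<sigma>))) \<rho> =
        Poly_Mapping.lookup 0 \<rho>"
      by simp
  qed
  note simplex = this
  show ?thesis
    by (rule free_Abelian_group_induct[OF assms,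
          where P = "\<lambda>c. simplicial_boundary \<omega> q (simplicial_boundary \<omega> (Suc q) c) = 0"])
      (simp_all add: simplex simplicial_boundary_diff)
qed

text \<open>The cochain below is the coboundary of a facet of \<open>\<tau>\<^sub>0\<close>. This facet may be empty,
  in which case the cochain is the augmentation.\<close>

lemma ex_nonzero_cocycle:
  assumes \<tau>0: "\<tau>\<^sub>0 \<in> simplices K p"
  obtains z :: "'v set \<Rightarrow> int" where "z \<tau>\<^sub>0 \<noteq> 0"
    and "\<And>\<sigma>. \<sigma> \<in> simplices K (Suc p) \<Longrightarrow>
      (\<Sum>\<tau>\<in>simplices K p. z \<tau> * Poly_Mapping.lookup (simplicial_boundary \<omega> (Suc p) (frag_of \<sigma>)) \<tau>) = 0"
proof -
  obtain h :: "'v \<Rightarrow> nat" where h: "inj_on h (\<Union>K)"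
    by (rule obtain_vertex_numbering)
  obtain u where u: "u \<in> \<tau>\<^sub>0"
    using \<tau>0 by (fastforce simp: simplices_def)
  \<comment> \<open>This is the incidence number of \<open>\<tau>\<close> with
    \<open>\<tau>\<^sub>0 - {u}\<close> without the orientation sign of that facet: the sign would
    be a common factor, and for \<open>p = 0\<close> the facet is empty and carries no
    orientation.\<close>
  define z where "z \<tau> = (\<Sum>w\<in>\<tau>. list_sign h (\<omega> \<tau>) * (-1) ^ rank h \<tau> w * of_bool (\<tau>\<^sub>0 - {u} = \<tau> - {w}))"
    for \<tau>
  have \<tau>0K: "\<tau>\<^sub>0 \<in> K" "finite \<tau>\<^sub>0"
    using \<tau>0 finite_simplex by (auto simp: simplices_def)
  have "z \<tau>\<^sub>0 = (\<Sum>w\<in>\<tau>\<^sub>0. if w = u then list_sign h (\<omega> \<tau>\<^sub>0) * (-1) ^ rank h \<tau>\<^sub>0 u else 0)"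
    unfolding z_def by (intro sum.cong refl) (use u in auto)
  also have "\<dots> = list_sign h (\<omega> \<tau>\<^sub>0) * (-1) ^ rank h \<tau>\<^sub>0 u"
    using u \<tau>0K by simp
  also have "\<dots> \<noteq> 0"
    using list_sign_orientation_square[OF h \<tau>0K(1)] by auto
  finally have "z \<tau>\<^sub>0 \<noteq> 0" .
  moreover have "(\<Sum>\<tau>\<in>simplices K p. z \<tau> *
      Poly_Mapping.lookup (simplicial_boundary \<omega> (Suc p) (frag_of \<sigma>)) \<tau>) = 0"
    if \<sigma>: "\<sigma> \<in> simplices K (Suc p)" for \<sigma>
  proof -
    have fin: "finite (simplices K p)"
      using finite_complex by (simp add: simplices_def)
    have "(\<Sum>\<tau>\<in>simplices K p. z \<tau> *
      Poly_Mapping.lookup (simplicial_boundary \<omega> (Suc p) (frag_of \<sigma>)) \<tau>) =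
      (\<Sum>\<tau>\<in>simplices K p. \<Sum>v\<in>\<sigma>. z \<tau> * (incidence h \<omega> \<sigma> v * of_bool (\<tau> = \<sigma> - {v})))"
      by (simp add: lookup_boundary_frag_of[OF h \<sigma>] sum_distrib_left)
    also have "\<dots> = (\<Sum>v\<in>\<sigma>. \<Sum>\<tau>\<in>simplices K p. z \<tau> * (incidence h \<omega> \<sigma> v * of_bool (\<tau> = \<sigma> - {v})))"
      by (rule sum.swap)
    also have "\<dots> = (\<Sum>v\<in>\<sigma>. incidence h \<omega> \<sigma> v * z (\<sigma> - {v}))"
    proof (intro sum.cong refl)
      fix v assume "v \<in> \<sigma>"
      then have "\<sigma> - {v} \<in> simplices K p"
        by (rule facet_in_simplices[OF \<sigma>])
      moreover have "(\<Sum>\<tau>\<in>simplices K p. z \<tau> * (incidence h \<omega> \<sigma> v * of_bool (\<tau> = \<sigma> - {v}))) =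
        (\<Sum>\<tau>\<in>simplices K p. if \<tau> = \<sigma> - {v} then incidence h \<omega> \<sigma> v * z (\<sigma> - {v}) else 0)"
        by (intro sum.cong) auto
      ultimately show "(\<Sum>\<tau>\<in>simplices K p. z \<tau> * (incidence h \<omega> \<sigma> v * of_bool (\<tau> = \<sigma> - {v}))) =
         incidence h \<omega> \<sigma> v * z (\<sigma> - {v})"
        using fin by simp
    qed
    also have "\<dots> = 0"
      unfolding z_def
      using incidence_sum_eq_0[OF h \<sigma>, of "\<lambda>\<rho>. of_bool (\<tau>\<^sub>0 - {u} = \<rho>)"] .
    finally show ?thesis .
  qed
  ultimately show ?thesis
    by (rule that)
qed

end

section \<open>Relative homology\<close>

lemma torsion_free_FactGroup_iff:
  assumes "comm_group G" "subgroup N G"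
  shows "torsion_free (G Mod N) \<longleftrightarrow> (\<forall>x\<in>carrier G. \<forall>n::nat. n > 0 \<longrightarrow> x [^]\<^bsub>G\<^esub> n \<in> N \<longrightarrow> x \<in> N)"
proof -
  interpret comm_group G by fact
  interpret normal N G
    using assms(2) by (rule subgroup_imp_normal)
  have "N #>\<^bsub>G\<^esub> y = N \<longleftrightarrow> y \<in> N" if "y \<in> carrier G" for y
    using coset_join1[OF _ that assms(2)] coset_join2[OF that assms(2)] by blast
  then show ?thesis
    by (simp add: torsion_free_def carrier_FactGroup FactGroup_pow)
qed

text \<open>The product of \<open>free_Abelian_group\<close> is addition of finitely supported
  functions, so a coset is a translate of \<open>N\<close> even when its representative lies outside
  the carrier.\<close>

lemma frag_coset_eq_iff:
  assumes "subgroup N (free_Abelian_group S)"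
  shows "N #>\<^bsub>free_Abelian_group S\<^esub> c = N #>\<^bsub>free_Abelian_group S\<^esub> d \<longleftrightarrow> c - d \<in> N"
proof -
  have N: "0 \<in> N" "\<And>a b. a \<in> N \<Longrightarrow> b \<in> N \<Longrightarrow> a + b \<in> N" "\<And>a. a \<in> N \<Longrightarrow> - a \<in> N"
    using assms subgroup.one_closed[OF assms] subgroup.m_closed[OF assms]
      subgroup.m_inv_closed[OF assms] subgroup.mem_carrier[OF assms] by fastforce+
  have coset: "N #>\<^bsub>free_Abelian_group S\<^esub> c = {a. a - c \<in> N}" for c
  proof -
    have "N #>\<^bsub>free_Abelian_group S\<^esub> c = (\<lambda>n. n + c) ` N"
      by (auto simp: r_coset_def)
    also have "\<dots> = {a. a - c \<in> N}"
      by (auto simp: image_iff) (metis diff_add_cancel)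
    finally show ?thesis .
  qed
  show ?thesis
  proof
    assume "N #>\<^bsub>free_Abelian_group S\<^esub> c = N #>\<^bsub>free_Abelian_group S\<^esub> d"
    then have "c \<in> {a. a - d \<in> N}"
      using N(1) unfolding coset by (metis (no_types, lifting) cancel_comm_monoid_add_class.diff_cancel mem_Collect_eq)
    then show "c - d \<in> N" by simp
  next
    assume cd: "c - d \<in> N"
    then have dc: "d - c \<in> N"
      using N(3) by fastforce
    have "a - c \<in> N \<longleftrightarrow> a - d \<in> N" for a
      using N(2)[of "a - c" "c - d"] N(2)[of "a - d" "d - c"] cd dc by auto
    then show "N #>\<^bsub>free_Abelian_group S\<^esub> c = N #>\<^bsub>free_Abelian_group S\<^esub> d"
      unfolding coset by simp
  qed
qed

lemma subgroup_free_Abelian_group: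
  assumes "S \<subseteq> T"
  shows "subgroup (carrier (free_Abelian_group S)) (free_Abelian_group T)"
proof (rule group.subgroupI)
  fix a b
  assume a: "a \<in> carrier (free_Abelian_group S)"
  then show "inv\<^bsub>free_Abelian_group T\<^esub> a \<in> carrier (free_Abelian_group S)"
    using assms by (subst inv_free_Abelian_group) auto
  assume b: "b \<in> carrier (free_Abelian_group S)"
  show "a \<otimes>\<^bsub>free_Abelian_group T\<^esub> b \<in> carrier (free_Abelian_group S)"
    using a b keys_add[of a b] by auto
next
  have "0 \<in> carrier (free_Abelian_group S)"
    by simp
  then show "carrier (free_Abelian_group S) \<noteq> {}"
    by blast
qed (use assms in auto)

lemma (in oriented_complex) keys_boundary:
  assumes "Poly_Mapping.keys c \<subseteq> simplices K (Suc q)"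
  shows "Poly_Mapping.keys (simplicial_boundary \<omega> (Suc q) c) \<subseteq> simplices K q"
proof -
  have "Poly_Mapping.keys (simplicial_boundary \<omega> (Suc q) c) \<subseteq>
      (\<Union>\<sigma>\<in>Poly_Mapping.keys c. Poly_Mapping.keys (simplicial_boundary \<omega> (Suc q) (frag_of \<sigma>)))"
    using keys_frag_extend[of "\<lambda>\<sigma>. simplicial_boundary \<omega> (Suc q) (frag_of \<sigma>)" c]
    by (simp add: simplicial_boundary_def)
  also have "\<dots> \<subseteq> simplices K q"
  proof (rule UN_least)
    fix \<sigma> assume "\<sigma> \<in> Poly_Mapping.keys c"
    then have \<sigma>: "\<sigma> \<in> simplices K (Suc q)" using assms by auto
    have "(\<lambda>v. \<sigma> - {v}) ` \<sigma> \<subseteq> simplices K q"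
      using facet_in_simplices[OF \<sigma>] by blast
    with keys_boundary_frag_of[OF \<sigma>]
    show "Poly_Mapping.keys (simplicial_boundary \<omega> (Suc q) (frag_of \<sigma>)) \<subseteq> simplices K q"
      by (rule subset_trans)
  qed
  finally show ?thesis .
qed

text \<open>In degree 0, where \<open>q - 1\<close> is again 0, the boundary vanishes. This uniform
  form spares the relative complex a case distinction on the degree.\<close>

lemma (in oriented_complex) keys_boundary_pred:
  assumes "Poly_Mapping.keys c \<subseteq> simplices K q"
  shows "Poly_Mapping.keys (simplicial_boundary \<omega> q c) \<subseteq> simplices K (q - 1)"
  using keys_boundary[of c "q - 1"] assms by (cases q) (simp_all add: simplicial_boundary_def)

section \<open>The relative chain complex of a pair\<close>

locale oriented_pair = oriented_complex L \<omega> for L and \<omega> :: "'v set \<Rightarrow> 'v list" +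
  fixes L0 :: "'v set set"
  assumes L0: "finite_simplicial_complex L0" and L0_subset: "L0 \<subseteq> L"
begin

sublocale sub: oriented_complex L0 \<omega>
  using L0 L0_subset \<omega> by unfold_locales (auto simp: orientation_of_def)

abbreviation N where "N q \<equiv> carrier (chain_group L0 q)"
abbreviation rel_class where "rel_class q c \<equiv> N q #>\<^bsub>chain_group L q\<^esub> c"

lemma mem_N: "c \<in> N q \<longleftrightarrow> Poly_Mapping.keys c \<subseteq> simplices L0 q"
  by (simp add: chain_group_def)

lemma carrier_chain_group: "c \<in> carrier (chain_group L q) \<longleftrightarrow> Poly_Mapping.keys c \<subseteq> simplices L q"
  by (simp add: chain_group_def)

lemma comm_group_chain_group: "comm_group (chain_group L q)"
  by (simp add: chain_group_def abelian_free_Abelian_group)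

lemma subgroup_N: "subgroup (N q) (chain_group L q)"
  unfolding chain_group_def
  by (rule subgroup_free_Abelian_group) (use L0_subset in \<open>auto simp: simplices_def\<close>)

lemma normal_N: "N q \<lhd> chain_group L q"
  by (rule comm_group.subgroup_imp_normal[OF comm_group_chain_group subgroup_N])

lemma comm_group_rel_chain_group: "comm_group (rel_chain_group L L0 q)"
  unfolding rel_chain_group_def
  by (rule comm_group.abelian_FactGroup[OF comm_group_chain_group subgroup_N])

lemma carrier_rel_chain_group:
  "carrier (rel_chain_group L L0 q) = rel_class q ` carrier (chain_group L q)"
  by (simp add: rel_chain_group_def carrier_FactGroup)

lemma one_rel_chain_group: "\<one>\<^bsub>rel_chain_group L L0 q\<^esub> = N q"
  by (simp add: rel_chain_group_def)

lemma rel_class_eq_iff: "rel_class q c = rel_class q d \<longleftrightarrow> c - d \<in> N q"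
  using frag_coset_eq_iff[of "N q" "simplices L q" c d] subgroup_N[of q] by (simp add: chain_group_def)

lemma rel_class_eq_one_iff: "rel_class q c = N q \<longleftrightarrow> c \<in> N q"
proof -
  have "rel_class q 0 = N q"
    by (auto simp: r_coset_def chain_group_def)
  then show ?thesis
    using rel_class_eq_iff[of q c 0] by simp
qed

lemma mult_rel_class:
  assumes "c \<in> carrier (chain_group L q)" "d \<in> carrier (chain_group L q)"
  shows "rel_class q c \<otimes>\<^bsub>rel_chain_group L L0 q\<^esub> rel_class q d = rel_class q (c + d)"
  using normal.rcos_sum[OF normal_N assms] by (simp add: rel_chain_group_def chain_group_def)

lemma pow_rel_class:
  assumes "c \<in> carrier (chain_group L q)"
  shows "rel_class q c [^]\<^bsub>rel_chain_group L L0 q\<^esub> (n::nat) = rel_class q (frag_cmul (int n) c)"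
  using normal.FactGroup_pow[OF normal_N assms, of n] by (simp add: rel_chain_group_def chain_group_def)

text \<open>Well-definedness: the boundary maps chains of \<open>L0\<close> to chains of
  \<open>L0\<close>, so all representatives of a class give one coset and \<open>the_elem\<close> is
  applied to a singleton.\<close>

lemma rel_boundary_rel_class:
  assumes "c \<in> carrier (chain_group L q)"
  shows "rel_boundary \<omega> L L0 q (rel_class q c) = rel_class (q - 1) (simplicial_boundary \<omega> q c)"
proof -
  have "rel_class (q - 1) (simplicial_boundary \<omega> q d) = rel_class (q - 1) (simplicial_boundary \<omega> q c)"
    if d: "d \<in> rel_class q c" for d
  proof -
    obtain n where "n \<in> N q" "d = n + c"
      using d by (auto simp: r_coset_def chain_group_def)
    then show ?thesis
      using sub.keys_boundary_pred[of n q] by (simp add: rel_class_eq_iff simplicial_boundary_add mem_N)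
  qed
  moreover have "c \<in> rel_class q c"
    using group.rcos_self[OF comm_group.axioms(2)[OF comm_group_chain_group] assms subgroup_N] .
  ultimately have "(\<lambda>d. rel_class (q - 1) (simplicial_boundary \<omega> q d)) ` rel_class q c =
      {rel_class (q - 1) (simplicial_boundary \<omega> q c)}"
    by blast
  then show ?thesis
    by (simp add: rel_boundary_def)
qed

lemma group_hom_rel_boundary:
  "group_hom (rel_chain_group L L0 q) (rel_chain_group L L0 (q - 1)) (rel_boundary \<omega> L L0 q)"
proof -
  have b: "simplicial_boundary \<omega> q c \<in> carrier (chain_group L (q - 1))"
    if "c \<in> carrier (chain_group L q)" for c
    using keys_boundary_pred[of c q] that by (simp add: carrier_chain_group)
  have add: "c + d \<in> carrier (chain_group L q)"
    if "c \<in> carrier (chain_group L q)" "d \<in> carrier (chain_group L q)" for c d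
    using that keys_add[of c d] unfolding carrier_chain_group by blast
  have "rel_boundary \<omega> L L0 q \<in> hom (rel_chain_group L L0 q) (rel_chain_group L L0 (q - 1))"
    unfolding hom_def carrier_rel_chain_group
    by (auto simp: mult_rel_class rel_boundary_rel_class b add simplicial_boundary_add
        simp del: One_nat_def)
  then show ?thesis
    using comm_group_rel_chain_group
    by (simp add: group_hom_def group_hom_axioms_def comm_group.axioms(2))
qed

lemma rel_class_in_rel_cycles_iff:
  assumes "c \<in> carrier (chain_group L q)"
  shows "rel_class q c \<in> rel_cycles \<omega> L L0 q \<longleftrightarrow> simplicial_boundary \<omega> q c \<in> N (q - 1)"
  unfolding rel_cycles_def kernel_def one_rel_chain_group
  using assms by (auto simp: rel_boundary_rel_class rel_class_eq_one_iff carrier_rel_chain_group)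

lemma rel_class_in_rel_boundaries_iff:
  "rel_class q c \<in> rel_boundaries \<omega> L L0 q \<longleftrightarrow>
    (\<exists>e \<in> carrier (chain_group L (Suc q)). c - simplicial_boundary \<omega> (Suc q) e \<in> N q)"
proof -
  have "rel_boundaries \<omega> L L0 q =
      (\<lambda>e. rel_class q (simplicial_boundary \<omega> (Suc q) e)) ` carrier (chain_group L (Suc q))"
    unfolding rel_boundaries_def carrier_rel_chain_group image_image
    by (rule image_cong) (simp_all add: rel_boundary_rel_class)
  then show ?thesis
    by (auto simp: rel_class_eq_iff)
qed

lemma subgroup_rel_cycles: "subgroup (rel_cycles \<omega> L L0 q) (rel_chain_group L L0 q)"
  unfolding rel_cycles_def by (rule group_hom.subgroup_kernel[OF group_hom_rel_boundary])

lemma subgroup_rel_boundaries: "subgroup (rel_boundaries \<omega> L L0 q) (rel_chain_group L L0 q)"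
  unfolding rel_boundaries_def
  using group_hom.img_is_subgroup[OF group_hom_rel_boundary[of "Suc q"]] by simp

text \<open>A representative differs from a boundary in \<open>L\<close> by a chain of
  \<open>L0\<close>. The former has zero boundary, and the boundary of the latter stays in
  \<open>L0\<close>.\<close>

lemma rel_boundaries_subset_cycles: "rel_boundaries \<omega> L L0 q \<subseteq> rel_cycles \<omega> L L0 q"
proof
  fix X assume X: "X \<in> rel_boundaries \<omega> L L0 q"
  then have "X \<in> carrier (rel_chain_group L L0 q)"
    using subgroup.mem_carrier[OF subgroup_rel_boundaries] by blast
  then obtain c where c: "c \<in> carrier (chain_group L q)" "X = rel_class q c"
    unfolding carrier_rel_chain_group by blast
  then obtain e where e: "e \<in> carrier (chain_group L (Suc q))"
      "c - simplicial_boundary \<omega> (Suc q) e \<in> N q"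
    using X rel_class_in_rel_boundaries_iff by blast
  have "simplicial_boundary \<omega> q (c - simplicial_boundary \<omega> (Suc q) e) \<in> N (q - 1)"
    using e(2) sub.keys_boundary_pred by (simp add: mem_N)
  then have "simplicial_boundary \<omega> q c \<in> N (q - 1)"
    using boundary_boundary[of e q] e(1) by (simp add: simplicial_boundary_diff carrier_chain_group)
  then show "X \<in> rel_cycles \<omega> L L0 q"
    using rel_class_in_rel_cycles_iff c by blast
qed

text \<open>A torsion class of the cokernel of the relative boundary operator is automatically a cycle,
  since the relative chain groups are torsion-free.\<close>

lemma torsion_free_rel_homology_iff:
  "torsion_free (rel_homology_group \<omega> L L0 q) \<longleftrightarrow>
    (\<forall>c e k. Poly_Mapping.keys c \<subseteq> simplices L q \<longrightarrow> Poly_Mapping.keys e \<subseteq> simplices L (Suc q) \<longrightarrow>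
       k \<noteq> 0 \<longrightarrow>
       Poly_Mapping.keys (frag_cmul k c - simplicial_boundary \<omega> (Suc q) e) \<subseteq> simplices L0 q \<longrightarrow>
       (\<exists>e'. Poly_Mapping.keys e' \<subseteq> simplices L (Suc q) \<and>
          Poly_Mapping.keys (c - simplicial_boundary \<omega> (Suc q) e') \<subseteq> simplices L0 q))"
    (is "_ \<longleftrightarrow> ?rhs")
proof -
  let ?R = "rel_chain_group L L0 q" and ?Z = "rel_cycles \<omega> L L0 q" and ?B = "rel_boundaries \<omega> L L0 q"
  interpret R: comm_group ?R by (rule comm_group_rel_chain_group)
  have Z: "carrier (subgroup_generated ?R ?Z) = ?Z"
    by (rule subgroup.carrier_subgroup_generated_subgroup[OF subgroup_rel_cycles])
  have "subgroup ?B (subgroup_generated ?R ?Z)"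
    using rel_boundaries_subset_cycles subgroup_rel_boundaries by (rule R.subgroup_of_subgroup_generated)
  then have "torsion_free (rel_homology_group \<omega> L L0 q) \<longleftrightarrow>
      (\<forall>X\<in>?Z. \<forall>n::nat. n > 0 \<longrightarrow> X [^]\<^bsub>?R\<^esub> n \<in> ?B \<longrightarrow> X \<in> ?B)" (is "_ \<longleftrightarrow> ?mid")
    unfolding rel_homology_group_def
    by (subst torsion_free_FactGroup_iff)
      (simp_all add: R.abelian_subgroup_generated R.comm_group_axioms Z pow_subgroup_generated)
  also have "?mid \<longleftrightarrow> ?rhs"
  proof
    assume mid: ?mid
    show ?rhs
    proof (intro allI impI)
      fix c e k
      assume c: "Poly_Mapping.keys c \<subseteq> simplices L q" and e: "Poly_Mapping.keys e \<subseteq> simplices L (Suc q)"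
        and k: "k \<noteq> (0::int)"
        and ke: "Poly_Mapping.keys (frag_cmul k c - simplicial_boundary \<omega> (Suc q) e) \<subseteq> simplices L0 q"
      \<comment> \<open>A torsion exponent is a natural number, while \<open>k\<close> may be
        negative, as a determinant may be later. The sign of \<open>k\<close> is moved into
        \<open>e\<close>.\<close>
      define n where "n = nat \<bar>k\<bar>"
      define e1 where "e1 = frag_cmul (sgn k) e"
      have e1: "Poly_Mapping.keys e1 \<subseteq> simplices L (Suc q)"
        using e keys_cmul[of "sgn k" e] by (auto simp: e1_def)
      have nk: "int n = sgn k * k"
        by (simp add: n_def sgn_if)
      have "frag_cmul (int n) c - simplicial_boundary \<omega> (Suc q) e1 =
          frag_cmul (sgn k) (frag_cmul k c - simplicial_boundary \<omega> (Suc q) e)"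
        unfolding nk e1_def simplicial_boundary_cmul
        by (rule poly_mapping_eqI) (simp add: lookup_minus right_diff_distrib mult.assoc)
      then have n: "frag_cmul (int n) c - simplicial_boundary \<omega> (Suc q) e1 \<in> N q"
        using ke keys_cmul by (fastforce simp: mem_N)
      \<comment> \<open>The double boundary drops out, so \<open>k\<close> times the boundary of
        \<open>c\<close> is supported in \<open>L0\<close>. A nonzero factor does not change
        supports; hence \<open>c\<close> is a relative cycle.\<close>
      have "simplicial_boundary \<omega> q (frag_cmul k c - simplicial_boundary \<omega> (Suc q) e) =
          frag_cmul k (simplicial_boundary \<omega> q c)"
        using boundary_boundary[OF e] by (simp add: simplicial_boundary_diff simplicial_boundary_cmul)
      then have "Poly_Mapping.keys (frag_cmul k (simplicial_boundary \<omega> q c)) \<subseteq> simplices L0 (q - 1)"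
        using sub.keys_boundary_pred[OF ke] by simp
      then have "simplicial_boundary \<omega> q c \<in> N (q - 1)"
        using k by (auto simp: mem_N)
      then have "rel_class q c \<in> ?Z"
        using c rel_class_in_rel_cycles_iff by (simp add: carrier_chain_group)
      moreover have "rel_class q c [^]\<^bsub>?R\<^esub> n \<in> ?B"
        using c e1 n rel_class_in_rel_boundaries_iff by (auto simp: pow_rel_class carrier_chain_group)
      moreover have "n > 0"
        using k by (simp add: n_def)
      ultimately have "rel_class q c \<in> ?B"
        using mid by blast
      then show "\<exists>e'. Poly_Mapping.keys e' \<subseteq> simplices L (Suc q) \<and>
          Poly_Mapping.keys (c - simplicial_boundary \<omega> (Suc q) e') \<subseteq> simplices L0 q"
        unfolding rel_class_in_rel_boundaries_iff Bex_def carrier_chain_group mem_N .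
    qed
  next
    assume rhs: ?rhs
    show ?mid
    proof (intro ballI allI impI)
      fix X and n :: nat
      assume X: "X \<in> ?Z" and n: "n > 0" and Xn: "X [^]\<^bsub>?R\<^esub> n \<in> ?B"
      obtain c where c: "c \<in> carrier (chain_group L q)" "X = rel_class q c"
        using subgroup.mem_carrier[OF subgroup_rel_cycles X] unfolding carrier_rel_chain_group by blast
      then obtain e where "e \<in> carrier (chain_group L (Suc q))"
          "frag_cmul (int n) c - simplicial_boundary \<omega> (Suc q) e \<in> N q"
        using Xn rel_class_in_rel_boundaries_iff by (auto simp: pow_rel_class)
      then have "\<exists>e'. Poly_Mapping.keys e' \<subseteq> simplices L (Suc q) \<and>
          Poly_Mapping.keys (c - simplicial_boundary \<omega> (Suc q) e') \<subseteq> simplices L0 q"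
        using c n by (intro rhs[rule_format, of c e "int n"]) (simp_all add: carrier_chain_group mem_N)
      then show "X \<in> ?B"
        unfolding c(2) rel_class_in_rel_boundaries_iff by (auto simp: carrier_chain_group mem_N)
    qed
  qed
  finally show ?thesis .
qed

end

section \<open>Integral solutions of totally unimodular systems\<close>

text \<open>Rows and columns are given by index sequences rather than sets. Reordering is then
  composition with a permutation, and bordering a minor is a function update; a sequence with
  repetitions just gives 0.\<close>

definition minor :: "('r \<Rightarrow> 'c \<Rightarrow> int) \<Rightarrow> nat \<Rightarrow> (nat \<Rightarrow> 'r) \<Rightarrow> (nat \<Rightarrow> 'c) \<Rightarrow> int" where
  "minor f n r c = det (mat n n (\<lambda>(i, j). f (r i) (c j)))"

definition minors_unimodular :: "'r set \<Rightarrow> 'c set \<Rightarrow> ('r \<Rightarrow> 'c \<Rightarrow> int) \<Rightarrow> bool" where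
  "minors_unimodular R C f \<longleftrightarrow>
     (\<forall>n r c. r ` {..<n} \<subseteq> R \<longrightarrow> c ` {..<n} \<subseteq> C \<longrightarrow> minor f n r c \<in> {-1, 0, 1})"

lemma minors_unimodular_mono:
  "minors_unimodular R C f \<Longrightarrow> R' \<subseteq> R \<Longrightarrow> C' \<subseteq> C \<Longrightarrow> minors_unimodular R' C' f"
  unfolding minors_unimodular_def by (meson subset_trans)

lemma minor_0 [simp]: "minor f 0 r c = 1"
  by (simp add: minor_def)

text \<open>Transfers facts about rows to columns.\<close>

lemma minor_transpose: "minor (\<lambda>y x. f x y) n c r = minor f n r c"
proof -
  have eq: "mat n n (\<lambda>(i, j). f (r j) (c i)) = transpose_mat (mat n n (\<lambda>(i, j). f (r i) (c j)))"
    by (rule eq_matI) auto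
  show ?thesis
    unfolding minor_def eq by (rule det_transpose) (rule mat_carrier)
qed

lemma minor_eq_0_if_not_inj_rows:
  assumes "\<not> inj_on r {..<n}"
  shows "minor f n r c = 0"
proof -
  obtain i j where ij: "i < n" "j < n" "i \<noteq> j" "r i = r j"
    using assms by (auto simp: inj_on_def)
  show ?thesis
    unfolding minor_def
    by (rule det_identical_rows[of _ n i j]) (use ij in \<open>auto simp: row_def intro!: eq_vecI\<close>)
qed

lemma minor_eq_0_if_not_inj_cols:
  "\<not> inj_on c {..<n} \<Longrightarrow> minor f n r c = 0"
  using minor_eq_0_if_not_inj_rows[of c n "\<lambda>y x. f x y" r] by (simp add: minor_transpose[of f])

lemma minor_permute_rows:
  assumes "\<pi> permutes {..<n}" "\<And>i. i < n \<Longrightarrow> r i = r' (\<pi> i)"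
  shows "minor f n r c = sign \<pi> * minor f n r' c"
proof -
  let ?A = "mat n n (\<lambda>(i, j). f (r' i) (c j))"
  have "mat n n (\<lambda>(i, j). f (r i) (c j)) = mat n n (\<lambda>(i, j). ?A $$ (\<pi> i, j))"
    using permutes_in_image[OF assms(1)] assms(2) by (intro eq_matI) auto
  then show ?thesis
    unfolding minor_def
    using det_permute_rows[of ?A n \<pi>] assms(1) by (simp add: lessThan_atLeast0)
qed

lemma minor_permute_cols:
  assumes "\<pi> permutes {..<n}" "\<And>i. i < n \<Longrightarrow> c i = c' (\<pi> i)"
  shows "minor f n r c = sign \<pi> * minor f n r c'"
  using minor_permute_rows[where r = c and r' = c' and f = "\<lambda>y x. f x y" and c = r, OF assms]
  by (simp add: minor_transpose[of f])

text \<open>\<open>submatrix\<close> lists its indices in increasing order through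
  \<open>pick\<close>. An injective sequence differs from this order by the permutation that sends
  \<open>i\<close> to the number of entries smaller than \<open>a i\<close>.\<close>

lemma inj_eq_pick_permutation:
  fixes n :: nat
  assumes "inj_on a {..<n}"
  obtains \<pi> where "\<pi> permutes {..<n}" "\<And>i. i < n \<Longrightarrow> a i = pick (a ` {..<n}) (\<pi> i)"
proof -
  let ?I = "a ` {..<n}"
  define \<pi> where "\<pi> i = (if i < n then card {x \<in> ?I. x < a i} else i)" for i
  have eq: "a i = pick ?I (\<pi> i)" if "i < n" for i
    using pick_card_in_set[of "a i" ?I] that by (simp add: \<pi>_def)
  have "card ?I = n"
    using assms by (simp add: card_image)
  have "\<pi> i < n" if "i < n" for i
  proof -
    have "{x \<in> ?I. x < a i} \<subset> ?I"
      using that by blast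
    then show ?thesis
      using psubset_card_mono[of ?I "{x \<in> ?I. x < a i}"] \<open>card ?I = n\<close> that by (simp add: \<pi>_def)
  qed
  then have "\<pi> ` {..<n} \<subseteq> {..<n}"
    by auto
  moreover have "inj_on \<pi> {..<n}"
  proof (rule inj_onI)
    fix i j
    assume ij: "i \<in> {..<n}" "j \<in> {..<n}" "\<pi> i = \<pi> j"
    then have "a i = a j"
      using eq[of i] eq[of j] by simp
    then show "i = j"
      using ij assms by (simp add: inj_on_eq_iff)
  qed
  ultimately have "bij_betw \<pi> {..<n} {..<n}"
    by (simp add: bij_betw_def endo_inj_surj)
  then have "\<pi> permutes {..<n}"
    by (rule bij_imp_permutes) (simp add: \<pi>_def)
  then show ?thesis
    using eq by (rule that)
qed

lemma ex_indices:
  assumes "f ` A \<subseteq> set xs"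
  shows "\<exists>a. \<forall>i\<in>A. a i < length xs \<and> f i = xs ! a i"
proof (rule bchoice, rule ballI)
  fix i assume "i \<in> A"
  then have "f i \<in> set xs" using assms by auto
  then show "\<exists>k. k < length xs \<and> f i = xs ! k"
    by (metis in_set_conv_nth)
qed

text \<open>A minor with a repeated index is 0, and any other agrees up to sign with the determinant
  of a \<open>submatrix\<close>; the set \<open>{-1, 0, 1}\<close> is closed under negation.\<close>

lemma totally_unimodular_iff_minors_unimodular:
  "totally_unimodular (mat (length xs) (length ys) (\<lambda>(i, j). f (xs ! i) (ys ! j))) \<longleftrightarrow>
    minors_unimodular (set xs) (set ys) f" (is "totally_unimodular ?A \<longleftrightarrow> _")
proof -
  have sub: "det (submatrix ?A I J) = minor f (card I) (\<lambda>i. xs ! pick I i) (\<lambda>j. ys ! pick J j)"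
    if "I \<subseteq> {..<length xs}" "J \<subseteq> {..<length ys}" "card I = card J" for I J
  proof -
    have IJ: "{i. i < length xs \<and> i \<in> I} = I" "{j. j < length ys \<and> j \<in> J} = J"
      using that by auto
    have pick: "pick I i < length xs" "pick J i < length ys" if "i < card I" for i
      using pick_in_set_le[of i I] pick_in_set_le[of i J] that
        \<open>I \<subseteq> {..<length xs}\<close> \<open>J \<subseteq> {..<length ys}\<close> \<open>card I = card J\<close> by auto
    have "submatrix ?A I J =
        mat (card I) (card I) (\<lambda>(i, j). f (xs ! pick I i) (ys ! pick J j))"
      using \<open>card I = card J\<close> by (intro eq_matI) (simp_all add: submatrix_def IJ pick)
    then show ?thesis
      by (simp add: minor_def)
  qed
  show ?thesis
  proof
    assume tu: "totally_unimodular ?A"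
    show "minors_unimodular (set xs) (set ys) f"
      unfolding minors_unimodular_def
    proof (intro allI impI)
      fix n :: nat and r c
      assume r: "r ` {..<n} \<subseteq> set xs" and c: "c ` {..<n} \<subseteq> set ys"
      show "minor f n r c \<in> {-1, 0, 1}"
      proof (cases "inj_on r {..<n} \<and> inj_on c {..<n}")
        case False
        then show ?thesis
          using minor_eq_0_if_not_inj_rows minor_eq_0_if_not_inj_cols by blast
      next
        case True
        obtain a where a: "\<And>i. i < n \<Longrightarrow> a i < length xs \<and> r i = xs ! a i"
          using ex_indices[OF r] by blast
        obtain b where b: "\<And>i. i < n \<Longrightarrow> b i < length ys \<and> c i = ys ! b i"
          using ex_indices[OF c] by blast
        have "inj_on (\<lambda>i. xs ! a i) {..<n}"
          using True a inj_on_cong[of "{..<n}" r "\<lambda>i. xs ! a i"] by simp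
        moreover have "inj_on (\<lambda>i. ys ! b i) {..<n}"
          using True b inj_on_cong[of "{..<n}" c "\<lambda>i. ys ! b i"] by simp
        ultimately have inj: "inj_on a {..<n}" "inj_on b {..<n}"
          by (auto simp: inj_on_def)
        let ?I = "a ` {..<n}" and ?J = "b ` {..<n}"
        have card: "card ?I = n" "card ?J = n"
          using inj by (auto simp: card_image)
        have sub_I: "?I \<subseteq> {..<length xs}" and sub_J: "?J \<subseteq> {..<length ys}"
          using a b by auto
        obtain \<pi> where \<pi>: "\<pi> permutes {..<n}" "\<And>i. i < n \<Longrightarrow> a i = pick ?I (\<pi> i)"
          using inj(1) by (rule inj_eq_pick_permutation) blast
        obtain \<rho> where \<rho>: "\<rho> permutes {..<n}" "\<And>i. i < n \<Longrightarrow> b i = pick ?J (\<rho> i)"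
          using inj(2) by (rule inj_eq_pick_permutation) blast
        have "minor f n r c = sign \<pi> * minor f n (\<lambda>i. xs ! pick ?I i) c"
          by (rule minor_permute_rows[OF \<pi>(1)]) (use a \<pi>(2) in simp)
        also have "\<dots> = sign \<pi> * (sign \<rho> * minor f n (\<lambda>i. xs ! pick ?I i) (\<lambda>j. ys ! pick ?J j))"
          by (subst minor_permute_cols[OF \<rho>(1), of c "\<lambda>j. ys ! pick ?J j"]) (use b \<rho>(2) in simp_all)
        also have "\<dots> = sign \<pi> * (sign \<rho> * det (submatrix ?A ?I ?J))"
          using sub[OF sub_I sub_J] card by simp
        finally have "minor f n r c = sign \<pi> * (sign \<rho> * det (submatrix ?A ?I ?J))" .
        moreover have "?I \<subseteq> {..<dim_row ?A}" "?J \<subseteq> {..<dim_col ?A}" "card ?I = card ?J"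
          using sub_I sub_J card by simp_all
        then have "det (submatrix ?A ?I ?J) \<in> {-1, 0, 1}"
          using tu unfolding totally_unimodular_def by blast
        ultimately show ?thesis
          by (auto simp: sign_def)
      qed
    qed
  next
    assume mu: "minors_unimodular (set xs) (set ys) f"
    show "totally_unimodular ?A"
      unfolding totally_unimodular_def
    proof (intro allI impI)
      fix I J
      assume "I \<subseteq> {..<dim_row ?A}" "J \<subseteq> {..<dim_col ?A}" "card I = card J"
      then have IJ: "I \<subseteq> {..<length xs}" "J \<subseteq> {..<length ys}" "card I = card J"
        by simp_all
      have "xs ! pick I i \<in> set xs" "ys ! pick J i \<in> set ys" if "i < card I" for i
        using pick_in_set_le[of i I] pick_in_set_le[of i J] that IJ by (auto intro!: nth_mem)
      then have "(\<lambda>i. xs ! pick I i) ` {..<card I} \<subseteq> set xs" "(\<lambda>j. ys ! pick J j) ` {..<card I} \<subseteq> set ys"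
        by blast+
      then have "minor f (card I) (\<lambda>i. xs ! pick I i) (\<lambda>j. ys ! pick J j) \<in> {-1, 0, 1}"
        using mu unfolding minors_unimodular_def by blast
      then show "det (submatrix ?A I J) \<in> {-1, 0, 1}"
        using sub[OF IJ] by simp
    qed
  qed
qed

text \<open>The identity of a matrix times its adjugate, written out entrywise: a right inverse up
  to the factor \<open>minor f n r c\<close>, obtained without division.\<close>

lemma ex_adjugate:
  fixes f :: "'r \<Rightarrow> 'c \<Rightarrow> int"
  shows "\<exists>g :: nat \<Rightarrow> nat \<Rightarrow> int. \<forall>i<n. \<forall>k<n.
      (\<Sum>j<n. f (r i) (c j) * g j k) = (if i = k then minor f n r c else 0)"
proof -
  define A where "A = mat n n (\<lambda>(i, j). f (r i) (c j))"
  have A: "A \<in> carrier_mat n n" by (simp add: A_def)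
  note adj = adj_mat[OF A]
  have "(\<Sum>j<n. f (r i) (c j) * adj_mat A $$ (j, k)) = (if i = k then minor f n r c else 0)"
    if "i < n" "k < n" for i k
  proof -
    have "(A * adj_mat A) $$ (i, k) = (\<Sum>j<n. f (r i) (c j) * adj_mat A $$ (j, k))"
      using adj(1) that by (auto simp: A_def scalar_prod_def lessThan_atLeast0 intro!: sum.cong)
    then show ?thesis
      using that unfolding adj(2) by (cases "i = k") (simp_all add: minor_def A_def)
  qed
  then show ?thesis
    by (intro exI[of _ "\<lambda>j k. adj_mat A $$ (j, k)"]) blast
qed

text \<open>Multiplying the relation between the rows by the adjugate leaves \<open>z k\<close>
  times the determinant.\<close>

lemma minor_eq_0_if_left_kernel:
  assumes "k < n" "z k \<noteq> 0" "\<And>j. j < n \<Longrightarrow> (\<Sum>i<n. z i * f (r i) (c j)) = 0"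
  shows "minor f n r c = 0"
proof -
  obtain g where g: "\<And>i k. i < n \<Longrightarrow> k < n \<Longrightarrow>
      (\<Sum>j<n. f (r i) (c j) * g j k) = (if i = k then minor f n r c else 0)"
    using ex_adjugate[of n f r c] by blast
  have "0 = (\<Sum>j<n. (\<Sum>i<n. z i * f (r i) (c j)) * g j k)"
    using assms(3) by simp
  also have "\<dots> = (\<Sum>j<n. \<Sum>i<n. z i * (f (r i) (c j) * g j k))"
    by (simp add: sum_distrib_right mult.assoc)
  also have "\<dots> = (\<Sum>i<n. \<Sum>j<n. z i * (f (r i) (c j) * g j k))"
    by (rule sum.swap)
  also have "\<dots> = (\<Sum>i<n. z i * (\<Sum>j<n. f (r i) (c j) * g j k))"
    by (simp add: sum_distrib_left)
  also have "\<dots> = (\<Sum>i<n. if i = k then z k * minor f n r c else 0)"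
    by (intro sum.cong refl) (use g assms(1) in simp)
  also have "\<dots> = z k * minor f n r c"
    using assms(1) by simp
  finally show ?thesis
    using assms(2) by simp
qed

text \<open>With an integral right inverse the determinant divides 1.\<close>

lemma minor_unit_if_surjective:
  assumes "\<And>i k. i < n \<Longrightarrow> k < n \<Longrightarrow> (\<Sum>j<n. f (r i) (c j) * x k j) = (if i = k then 1 else 0)"
  shows "minor f n r c \<in> {-1, 1}"
proof -
  let ?A = "mat n n (\<lambda>(i, j). f (r i) (c j))"
  let ?X = "mat n n (\<lambda>(j, k). x k j)"
  have "?A * ?X = 1\<^sub>m n"
  proof (rule eq_matI)
    fix i k
    assume "i < dim_row (1\<^sub>m n)" "k < dim_col (1\<^sub>m n)"
    then have ik: "i < n" "k < n" by auto
    then have "(?A * ?X) $$ (i, k) = (\<Sum>j<n. f (r i) (c j) * x k j)"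
      by (auto simp: scalar_prod_def lessThan_atLeast0 intro!: sum.cong)
    then show "(?A * ?X) $$ (i, k) = 1\<^sub>m n $$ (i, k)"
      using assms[OF ik] ik by simp
  qed auto
  then have "det ?A * det ?X = 1"
    using det_mult[of ?A n ?X] by simp
  then show ?thesis
    unfolding minor_def by (auto simp: zmult_eq_1_iff)
qed

text \<open>Maximality of the nonzero minor makes every row a rational combination of the rows of the
  minor, and the coefficients (cofactors of the bordered minors) do not depend on the column.\<close>

lemma row_dependence:
  assumes "s \<in> R"
    and "\<And>t. t \<in> C \<Longrightarrow> minor f (Suc m) (r(m := s)) (c(m := t)) = 0"
  obtains w where "\<And>t. t \<in> C \<Longrightarrow> (\<Sum>i<m. w i * f (r i) t) + minor f m r c * f s t = 0"
proof -
  let ?M = "\<lambda>t. mat (Suc m) (Suc m) (\<lambda>(i, j). f ((r(m := s)) i) ((c(m := t)) j))"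
  define w where "w i = (-1) ^ (i + m) *
      det (mat m m (\<lambda>(k, j). f ((r(m := s)) (insert_index i k)) (c j)))" for i
  have cof: "cofactor (?M t) i m = w i" if "i < Suc m" for i t
  proof -
    have "mat_delete (?M t) i m = mat m m (\<lambda>(k, j). f ((r(m := s)) (insert_index i k)) (c j))"
    proof (rule eq_matI, goal_cases)
      case (1 k j)
      then have "k < m" "j < m" by auto
      then have "mat_delete (?M t) i m $$ (k, j) = ?M t $$ (insert_index i k, insert_index m j)"
        using mat_delete_index[of "?M t" m i m k j] that by simp
      also have "\<dots> = f ((r(m := s)) (insert_index i k)) (c j)"
        using \<open>k < m\<close> \<open>j < m\<close> by (auto simp: insert_index_def)
      finally show ?case using \<open>k < m\<close> \<open>j < m\<close> by simp
    qed auto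
    then show ?thesis
      by (simp add: cofactor_def w_def)
  qed
  have "mat m m (\<lambda>(k, j). f ((r(m := s)) (insert_index m k)) (c j)) = mat m m (\<lambda>(i, j). f (r i) (c j))"
    by (rule eq_matI) (auto simp: insert_index_def)
  then have wm: "w m = minor f m r c"
    by (simp add: w_def minor_def flip: mult_2)
  have "(\<Sum>i<m. w i * f (r i) t) + minor f m r c * f s t = 0" if "t \<in> C" for t
  proof -
    have "0 = det (?M t)"
      using assms(2)[OF that] by (simp add: minor_def)
    also have "\<dots> = (\<Sum>i<Suc m. ?M t $$ (i, m) * cofactor (?M t) i m)"
      by (rule laplace_expansion_column) auto
    also have "\<dots> = (\<Sum>i<Suc m. f ((r(m := s)) i) t * w i)"
      by (intro sum.cong refl) (simp add: cof fun_upd_same del: fun_upd_apply)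
    also have "\<dots> = (\<Sum>i<m. w i * f (r i) t) + minor f m r c * f s t"
      by (simp add: wm mult.commute)
    finally show ?thesis by simp
  qed
  then show ?thesis by (rule that)
qed

text \<open>A vector in the image is determined by its values on the rows of a maximal nonzero
  minor. The vector \<open>y\<close> obeys the same row dependences because a nonzero multiple of it
  is in the image, so an integral vector whose image agrees with \<open>y\<close> on those rows
  solves the whole system.\<close>

lemma integral_solution:
  fixes f :: "'r \<Rightarrow> 'c \<Rightarrow> int"
  assumes mu: "minors_unimodular R C f" and fin: "finite C" and k: "k \<noteq> 0"
    and sol: "\<And>\<tau>. \<tau> \<in> R \<Longrightarrow> k * y \<tau> = (\<Sum>\<sigma>\<in>C. f \<tau> \<sigma> * x \<sigma>)"
  shows "\<exists>x'. \<forall>\<tau>\<in>R. y \<tau> = (\<Sum>\<sigma>\<in>C. f \<tau> \<sigma> * x' \<sigma>)"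
proof -
  \<comment> \<open>\<open>P m\<close> asks for a nonzero minor of order \<open>m\<close>. The empty
    minor is 1, and a nonzero minor has distinct columns, so the orders are bounded by
    \<open>card C\<close> and a largest one exists.\<close>
  define P where "P m \<longleftrightarrow> (\<exists>r c. r ` {..<m} \<subseteq> R \<and> c ` {..<m} \<subseteq> C \<and> minor f m r c \<noteq> 0)" for m :: nat
  have "P 0"
    by (simp add: P_def)
  moreover have bound: "m \<le> card C" if Pm: "P m" for m
  proof -
    obtain r c where "c ` {..<m} \<subseteq> C" "minor f m r c \<noteq> 0"
      using Pm unfolding P_def by blast
    then have "inj_on c {..<m}"
      using minor_eq_0_if_not_inj_cols by blast
    then show ?thesis
      using card_inj_on_le[of c "{..<m}" C] \<open>c ` {..<m} \<subseteq> C\<close> fin by simp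
  qed
  ultimately have "P (GREATEST m. P m)" "m \<le> (GREATEST m. P m)" if "P m" for m
    using that by (auto intro: GreatestI_nat Greatest_le_nat)
  then obtain m where m: "P m" "\<And>m'. P m' \<Longrightarrow> m' \<le> m"
    using \<open>P 0\<close> by blast
  obtain r c where r: "r ` {..<m} \<subseteq> R" and c: "c ` {..<m} \<subseteq> C" and d0: "minor f m r c \<noteq> 0"
    using m(1) unfolding P_def by blast
  define d where "d = minor f m r c"
  have dd: "d * d = 1"
  proof -
    have "d \<in> {-1, 0, 1}"
      using mu r c unfolding minors_unimodular_def d_def by blast
    then show ?thesis
      using d0 by (auto simp: d_def)
  qed
  have dep: "\<exists>w. \<forall>t\<in>C. (\<Sum>i<m. w i * f (r i) t) + d * f s t = 0" if s: "s \<in> R" for s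
  proof -
    have "minor f (Suc m) (r(m := s)) (c(m := t)) = 0" if "t \<in> C" for t
    proof (rule ccontr)
      assume "minor f (Suc m) (r(m := s)) (c(m := t)) \<noteq> 0"
      moreover have "(r(m := s)) ` {..<Suc m} \<subseteq> R" "(c(m := t)) ` {..<Suc m} \<subseteq> C"
        using r c s that by (auto simp: less_Suc_eq)
      ultimately have "P (Suc m)"
        unfolding P_def by blast
      then show False
        using m(2)[of "Suc m"] by simp
    qed
    then show ?thesis
      unfolding d_def by (rule row_dependence[OF s, of C f m r c]) blast+
  qed
  obtain g where g: "\<And>i k. i < m \<Longrightarrow> k < m \<Longrightarrow>
      (\<Sum>j<m. f (r i) (c j) * g j k) = (if i = k then d else 0)"
    unfolding d_def using ex_adjugate[of m f r c] by blast
  \<comment> \<open>As \<open>d * d = 1\<close>, the matrix \<open>d * g\<close> is an integral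
    inverse of the minor; \<open>u\<close> is its product with the values of \<open>y\<close> on the
    rows \<open>r\<close>. The vector \<open>x'\<close> places \<open>u\<close> in the columns
    \<open>c\<close> and is 0 elsewhere.\<close>
  define u where "u j = (\<Sum>l<m. d * g j l * y (r l))" for j
  define x' where "x' \<sigma> = (\<Sum>j<m. if \<sigma> = c j then u j else 0)" for \<sigma>
  define F where "F x \<tau> = (\<Sum>\<sigma>\<in>C. f \<tau> \<sigma> * x \<sigma>)" for x \<tau>
  have Fx': "F x' (r i) = y (r i)" if "i < m" for i
  proof -
    have "F x' (r i) = (\<Sum>\<sigma>\<in>C. \<Sum>j<m. if \<sigma> = c j then f (r i) (c j) * u j else 0)"
      unfolding F_def x'_def sum_distrib_left by (intro sum.cong) auto
    also have "\<dots> = (\<Sum>j<m. \<Sum>\<sigma>\<in>C. if \<sigma> = c j then f (r i) (c j) * u j else 0)"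
      by (rule sum.swap)
    also have "\<dots> = (\<Sum>j<m. f (r i) (c j) * u j)"
      by (intro sum.cong refl) (use c fin in auto)
    also have "\<dots> = (\<Sum>j<m. \<Sum>l<m. d * y (r l) * (f (r i) (c j) * g j l))"
      unfolding u_def sum_distrib_left by (simp add: mult_ac)
    also have "\<dots> = (\<Sum>l<m. \<Sum>j<m. d * y (r l) * (f (r i) (c j) * g j l))"
      by (rule sum.swap)
    also have "\<dots> = (\<Sum>l<m. d * y (r l) * (\<Sum>j<m. f (r i) (c j) * g j l))"
      by (simp add: sum_distrib_left)
    also have "\<dots> = (\<Sum>l<m. if l = i then d * d * y (r i) else 0)"
      by (intro sum.cong refl) (use g that in auto)
    also have "\<dots> = y (r i)"
      using that dd by simp
    finally show ?thesis .
  qed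
  have "y s = F x' s" if s: "s \<in> R" for s
  proof -
    obtain w where w: "\<And>t. t \<in> C \<Longrightarrow> (\<Sum>i<m. w i * f (r i) t) + d * f s t = 0"
      using dep[OF s] by blast
    \<comment> \<open>The row dependence passes to the image of every \<open>x\<close>. It is used
      for the given solution, where \<open>k\<close> is cancelled afterwards, and for
      \<open>x'\<close>.\<close>
    have F: "(\<Sum>i<m. w i * F x (r i)) + d * F x s = 0" for x
    proof -
      have "(\<Sum>i<m. w i * F x (r i)) = (\<Sum>i<m. \<Sum>t\<in>C. w i * f (r i) t * x t)"
        by (simp add: F_def sum_distrib_left mult.assoc)
      also have "\<dots> = (\<Sum>t\<in>C. \<Sum>i<m. w i * f (r i) t * x t)"
        by (rule sum.swap)
      finally have "(\<Sum>i<m. w i * F x (r i)) + d * F x s =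
          (\<Sum>t\<in>C. ((\<Sum>i<m. w i * f (r i) t) + d * f s t) * x t)"
        by (simp add: F_def sum_distrib_left sum_distrib_right distrib_right sum.distrib mult.assoc)
      then show ?thesis
        using w by simp
    qed
    have "k * ((\<Sum>i<m. w i * y (r i)) + d * y s) = (\<Sum>i<m. w i * (k * y (r i))) + d * (k * y s)"
      by (simp add: distrib_left sum_distrib_left mult_ac)
    also have "\<dots> = (\<Sum>i<m. w i * F x (r i)) + d * F x s"
      using sol s r by (auto simp: F_def image_subset_iff)
    finally have "(\<Sum>i<m. w i * y (r i)) + d * y s = 0"
      using F k by simp
    moreover have "(\<Sum>i<m. w i * y (r i)) + d * F x' s = 0"
      using F[of x'] Fx' by simp
    ultimately have "d * y s = d * F x' s"
      by linarith
    then show ?thesis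
      using dd by auto
  qed
  then show ?thesis
    unfolding F_def by blast
qed

section \<open>Boundary matrices of pure pairs\<close>

text \<open>Has the shape required in \<open>pure_complex\<close>, so that the generators are the
  witness there.\<close>

definition generated_complex :: "'v set set \<Rightarrow> 'v set set" where
  "generated_complex S = {\<tau>. \<tau> \<noteq> {} \<and> (\<exists>\<sigma>\<in>S. \<tau> \<subseteq> \<sigma>)}"

text \<open>A face with as many vertices as the generator containing it equals that generator, so no
  further top simplices arise. An empty family would generate the complex of dimension -1; hence the
  later need for \<open>F0 \<noteq> {}\<close>.\<close>

lemma generated_complex_pure:
  assumes "finite S" "S \<noteq> {}" "\<forall>\<sigma>\<in>S. card \<sigma> = Suc q"
  shows "pure_complex q (generated_complex S)" and "simplices (generated_complex S) q = S"
proof -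
  let ?L = "generated_complex S"
  have card: "card \<sigma> = Suc q" if "\<sigma> \<in> S" for \<sigma>
    using assms(3) that by blast
  have fin: "finite \<sigma>" if "\<sigma> \<in> S" for \<sigma>
    using card[OF that] by (simp add: card_ge_0_finite)
  have sub: "S \<subseteq> ?L"
    using card unfolding generated_complex_def by fastforce
  have finL: "finite ?L"
  proof (rule finite_subset)
    show "?L \<subseteq> (\<Union>\<sigma>\<in>S. Pow \<sigma>)"
      unfolding generated_complex_def by blast
    show "finite (\<Union>\<sigma>\<in>S. Pow \<sigma>)"
      using assms(1) fin by simp
  qed
  have face: "finite \<tau> \<and> card \<tau> \<le> Suc q" if \<tau>: "\<tau> \<in> ?L" for \<tau>
  proof -
    obtain \<sigma> where \<sigma>: "\<sigma> \<in> S" "\<tau> \<subseteq> \<sigma>"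
      using \<tau> unfolding generated_complex_def by blast
    then show ?thesis
      using fin[OF \<sigma>(1)] card[OF \<sigma>(1)] card_mono[of \<sigma> \<tau>] finite_subset[of \<tau> \<sigma>] by simp
  qed
  have "finite_simplicial_complex ?L"
    unfolding finite_simplicial_complex_def
  proof (intro conjI ballI allI impI)
    show "\<tau> \<in> ?L" if "\<sigma> \<in> ?L" "\<tau> \<subseteq> \<sigma>" "\<tau> \<noteq> {}" for \<sigma> \<tau>
      using that unfolding generated_complex_def by blast
  qed (use finL face in \<open>auto simp: generated_complex_def\<close>)
  moreover have "complex_dim ?L = int q"
  proof -
    have "Max ((\<lambda>\<sigma>. int (card \<sigma>) - 1) ` ?L) = int q"
    proof (rule Max_eqI)
      show "finite ((\<lambda>\<sigma>. int (card \<sigma>) - 1) ` ?L)"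
        using finL by simp
      show "d \<le> int q" if d: "d \<in> (\<lambda>\<sigma>. int (card \<sigma>) - 1) ` ?L" for d
        using d face by fastforce
      obtain \<sigma> where "\<sigma> \<in> S" using assms(2) by blast
      then show "int q \<in> (\<lambda>\<sigma>. int (card \<sigma>) - 1) ` ?L"
        using sub card by (intro image_eqI[of _ _ \<sigma>]) auto
    qed
    then show ?thesis
      using sub assms(2) by (auto simp: complex_dim_def)
  qed
  ultimately show "pure_complex q ?L"
    unfolding pure_complex_def generated_complex_def using card by blast
  show "simplices ?L q = S"
  proof
    show "S \<subseteq> simplices ?L q"
      using sub card by (auto simp: simplices_def)
    show "simplices ?L q \<subseteq> S"
    proof
      fix \<tau> assume \<tau>: "\<tau> \<in> simplices ?L q"
      then obtain \<sigma> where \<sigma>: "\<sigma> \<in> S" "\<tau> \<subseteq> \<sigma>"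
        unfolding simplices_def generated_complex_def by blast
      then have "\<tau> = \<sigma>"
        using \<tau> fin[OF \<sigma>(1)] card[OF \<sigma>(1)] by (intro card_subset_eq) (auto simp: simplices_def)
      with \<sigma> show "\<tau> \<in> S" by simp
    qed
  qed
qed

text \<open>Matrix entries indexed by simplices instead of positions. They depend on
  \<open>\<omega>\<close> but not on a complex, so passing to a subcomplex only selects rows and
  columns.\<close>

definition boundary_coeff :: "('v set \<Rightarrow> 'v list) \<Rightarrow> nat \<Rightarrow> 'v set \<Rightarrow> 'v set \<Rightarrow> int" where
  "boundary_coeff \<omega> q \<tau> \<sigma> = Poly_Mapping.lookup (simplicial_boundary \<omega> q (frag_of \<sigma>)) \<tau>"

lemma lookup_simplicial_boundary:
  assumes "finite S" "Poly_Mapping.keys e \<subseteq> S"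
  shows "Poly_Mapping.lookup (simplicial_boundary \<omega> q e) \<tau> =
    (\<Sum>\<sigma>\<in>S. boundary_coeff \<omega> q \<tau> \<sigma> * Poly_Mapping.lookup e \<sigma>)"
proof -
  have "Poly_Mapping.lookup (simplicial_boundary \<omega> q e) \<tau> =
      (\<Sum>\<sigma>\<in>Poly_Mapping.keys e. boundary_coeff \<omega> q \<tau> \<sigma> * Poly_Mapping.lookup e \<sigma>)"
  proof (cases "q = 0")
    case False
    then show ?thesis
      unfolding simplicial_boundary_def boundary_coeff_def frag_extend_def[of _ e]
      by (simp add: lookup_sum mult.commute)
  qed (simp add: boundary_coeff_def simplicial_boundary_def)
  also have "\<dots> = (\<Sum>\<sigma>\<in>S. boundary_coeff \<omega> q \<tau> \<sigma> * Poly_Mapping.lookup e \<sigma>)"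
    by (rule sum.mono_neutral_left) (use assms in \<open>auto simp: in_keys_iff\<close>)
  finally show ?thesis .
qed

lemma frag_combination:
  assumes "finite S"
  shows "Poly_Mapping.lookup (\<Sum>\<sigma>\<in>S. frag_cmul (x \<sigma>) (frag_of \<sigma>)) \<tau> = (if \<tau> \<in> S then x \<tau> else 0)"
    and "Poly_Mapping.keys (\<Sum>\<sigma>\<in>S. frag_cmul (x \<sigma>) (frag_of \<sigma>)) \<subseteq> S"
proof -
  have *: "Poly_Mapping.lookup (\<Sum>\<sigma>\<in>S. frag_cmul (x \<sigma>) (frag_of \<sigma>)) \<tau> = (if \<tau> \<in> S then x \<tau> else 0)" for \<tau>
  proof -
    have "Poly_Mapping.lookup (\<Sum>\<sigma>\<in>S. frag_cmul (x \<sigma>) (frag_of \<sigma>)) \<tau> =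
        (\<Sum>\<sigma>\<in>S. if \<sigma> = \<tau> then x \<tau> else 0)"
      unfolding lookup_sum by (intro sum.cong refl) auto
    then show ?thesis using assms by simp
  qed
  then show "Poly_Mapping.lookup (\<Sum>\<sigma>\<in>S. frag_cmul (x \<sigma>) (frag_of \<sigma>)) \<tau> = (if \<tau> \<in> S then x \<tau> else 0)" .
  show "Poly_Mapping.keys (\<Sum>\<sigma>\<in>S. frag_cmul (x \<sigma>) (frag_of \<sigma>)) \<subseteq> S"
  proof
    fix \<tau> assume "\<tau> \<in> Poly_Mapping.keys (\<Sum>\<sigma>\<in>S. frag_cmul (x \<sigma>) (frag_of \<sigma>))"
    then show "\<tau> \<in> S"
      unfolding in_keys_iff * by presburger
  qed
qed

section \<open>Unimodular minors and relative torsion\<close>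

lemma (in oriented_complex) finite_simplices: "finite (simplices K q)"
  using finite_complex by (simp add: simplices_def)

text \<open>Equality modulo chains of \<open>L0\<close> means equality of the coefficients on the
  rows \<open>?F - ?E\<close>, so a torsion relation is a linear system to which
  \<open>integral_solution\<close> applies.\<close>

lemma (in oriented_pair) torsion_free_if_minors_unimodular:
  assumes "minors_unimodular (simplices L p) (simplices L (Suc p)) (boundary_coeff \<omega> (Suc p))"
  shows "torsion_free (rel_homology_group \<omega> L L0 p)"
  unfolding torsion_free_rel_homology_iff
proof (intro allI impI)
  fix c e and k :: int
  let ?F = "simplices L p" and ?E = "simplices L0 p" and ?C = "simplices L (Suc p)"
  assume c: "Poly_Mapping.keys c \<subseteq> ?F" and e: "Poly_Mapping.keys e \<subseteq> ?C" and k: "k \<noteq> 0"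
    and ke: "Poly_Mapping.keys (frag_cmul k c - simplicial_boundary \<omega> (Suc p) e) \<subseteq> ?E"
  have mu: "minors_unimodular (?F - ?E) ?C (boundary_coeff \<omega> (Suc p))"
    using assms by (rule minors_unimodular_mono) auto
  have sol: "k * Poly_Mapping.lookup c \<tau> = (\<Sum>\<sigma>\<in>?C. boundary_coeff \<omega> (Suc p) \<tau> \<sigma> * Poly_Mapping.lookup e \<sigma>)"
    if \<tau>: "\<tau> \<in> ?F - ?E" for \<tau>
  proof -
    have "\<tau> \<notin> Poly_Mapping.keys (frag_cmul k c - simplicial_boundary \<omega> (Suc p) e)"
      using \<tau> ke by blast
    then show ?thesis
      by (simp add: in_keys_iff lookup_minus lookup_simplicial_boundary[OF finite_simplices e])
  qed
  obtain x where x: "\<forall>\<tau>\<in>?F - ?E.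
      Poly_Mapping.lookup c \<tau> = (\<Sum>\<sigma>\<in>?C. boundary_coeff \<omega> (Suc p) \<tau> \<sigma> * x \<sigma>)"
    using integral_solution[where y = "Poly_Mapping.lookup c", OF mu finite_simplices k sol] by blast
  define e' where "e' = (\<Sum>\<sigma>\<in>?C. frag_cmul (x \<sigma>) (frag_of \<sigma>))"
  have e': "Poly_Mapping.keys e' \<subseteq> ?C"
    unfolding e'_def by (rule frag_combination(2)[OF finite_simplices])
  moreover have "Poly_Mapping.keys (c - simplicial_boundary \<omega> (Suc p) e') \<subseteq> ?E"
  proof (rule subsetI, rule ccontr)
    fix \<tau>
    assume \<tau>: "\<tau> \<in> Poly_Mapping.keys (c - simplicial_boundary \<omega> (Suc p) e')" "\<tau> \<notin> ?E"
    \<comment> \<open>Only rows in \<open>?F\<close> need checking, because \<open>c\<close> and the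
      boundary of \<open>e'\<close> are both supported there.\<close>
    have "Poly_Mapping.keys (c - simplicial_boundary \<omega> (Suc p) e') \<subseteq> ?F"
      using keys_diff[of c "simplicial_boundary \<omega> (Suc p) e'"] c keys_boundary[OF e'] by (meson Un_least subset_trans)
    with \<tau> have \<tau>F: "\<tau> \<in> ?F - ?E"
      by blast
    have "(\<Sum>\<sigma>\<in>?C. boundary_coeff \<omega> (Suc p) \<tau> \<sigma> * x \<sigma>) =
        (\<Sum>\<sigma>\<in>?C. boundary_coeff \<omega> (Suc p) \<tau> \<sigma> * Poly_Mapping.lookup e' \<sigma>)"
      by (rule sum.cong) (simp_all add: e'_def frag_combination(1)[OF finite_simplices])
    then have "Poly_Mapping.lookup c \<tau> = Poly_Mapping.lookup (simplicial_boundary \<omega> (Suc p) e') \<tau>"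
      unfolding lookup_simplicial_boundary[OF finite_simplices e'] using x \<tau>F by metis
    with \<tau>(1) show False
      by (simp add: in_keys_iff lookup_minus)
  qed
  ultimately show "\<exists>e'. Poly_Mapping.keys e' \<subseteq> ?C \<and>
      Poly_Mapping.keys (c - simplicial_boundary \<omega> (Suc p) e') \<subseteq> ?E"
    by blast
qed

text \<open>Column \<open>k\<close> of the adjugate is a chain whose boundary equals
  \<open>D\<close> times \<open>r k\<close> on the rows of the minor, so \<open>r k\<close> is
  torsion modulo boundaries and \<open>L0\<close>. Torsion-freeness makes every \<open>r k\<close> a
  relative boundary, and the chains obtained form an integral right inverse.\<close>

lemma (in oriented_complex) minors_unimodular_if_torsion_free:
  assumes tf: "\<And>L0 L. pure_complex p L0 \<Longrightarrow> pure_complex (Suc p) L \<Longrightarrow> L0 \<subseteq> L \<Longrightarrow> L \<subseteq> K \<Longrightarrow>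
      torsion_free (rel_homology_group \<omega> L L0 p)"
  shows "minors_unimodular (simplices K p) (simplices K (Suc p)) (boundary_coeff \<omega> (Suc p))"
  unfolding minors_unimodular_def
proof (intro allI impI, rule ccontr)
  fix n :: nat and r c :: "nat \<Rightarrow> 'v set"
  let ?f = "boundary_coeff \<omega> (Suc p)"
  let ?I = "r ` {..<n}" and ?J = "c ` {..<n}"
  define D where "D = minor ?f n r c"
  assume r: "?I \<subseteq> simplices K p" and c: "?J \<subseteq> simplices K (Suc p)"
    and "minor ?f n r c \<notin> {-1, 0, 1}"
  then have D: "D \<noteq> 0" "D \<notin> {-1, 1}"
    by (auto simp: D_def)
  \<comment> \<open>The empty minor is 1. Hence \<open>?J\<close> is nonempty and generates a
    complex of dimension \<open>p + 1\<close>.\<close>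
  have n: "n > 0"
    using D(2) by (cases n) (auto simp: D_def)
  have inj: "inj_on r {..<n}" "inj_on c {..<n}"
    using D(1) minor_eq_0_if_not_inj_rows minor_eq_0_if_not_inj_cols unfolding D_def by blast+
  define L where "L = generated_complex ?J"
  have "finite ?J" "?J \<noteq> {}" "\<forall>\<sigma>\<in>?J. card \<sigma> = Suc (Suc p)"
    using n c by (auto simp: simplices_def)
  note L = generated_complex_pure[OF this, folded L_def]
  have LK: "L \<subseteq> K"
    using c face_in_complex unfolding L_def generated_complex_def simplices_def by blast
  interpret L: oriented_complex L \<omega>
    using L(1) \<omega> LK by unfold_locales (auto simp: pure_complex_def orientation_of_def)
  have face: "\<tau> \<in> simplices L p" if "?f \<tau> (c j) \<noteq> 0" "j < n" for \<tau> j
  proof -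
    have cj: "c j \<in> simplices L (Suc p)"
      using L(2) that(2) by blast
    have "\<tau> \<in> Poly_Mapping.keys (simplicial_boundary \<omega> (Suc p) (frag_of (c j)))"
      using that(1) by (simp add: boundary_coeff_def in_keys_iff)
    then show ?thesis
      using L.keys_boundary_frag_of[OF cj] L.facet_in_simplices[OF cj] by blast
  qed
  have rL: "?I \<subseteq> simplices L p"
  proof (rule ccontr)
    assume "\<not> ?I \<subseteq> simplices L p"
    then obtain k where k: "k < n" "r k \<notin> simplices L p" by blast
    have "minor ?f n r c = 0"
    \<comment> \<open>A row simplex outside \<open>L\<close> is a facet of no column simplex. Its
      row is zero, so the indicator of \<open>k\<close> is a left kernel vector.\<close>
    proof (rule minor_eq_0_if_left_kernel[OF k(1), of "\<lambda>i. if i = k then 1 else 0"])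
      show "(if k = k then 1 else 0) \<noteq> (0::int)" by simp
      fix j assume "j < n"
      then have "?f (r k) (c j) = 0"
        using face k(2) by blast
      then show "(\<Sum>i<n. (if i = k then 1 else 0) * ?f (r i) (c j)) = 0"
        by (intro sum.neutral) auto
    qed
    then show False using D(1) by (simp add: D_def)
  qed
  define F0 where "F0 = simplices L p - ?I"
  have "F0 \<noteq> {}"
  proof
    assume "F0 = {}"
    then have LI: "simplices L p \<subseteq> ?I" by (auto simp: F0_def)
    have "r 0 \<in> simplices K p" using r n by auto
    then obtain z where z: "z (r 0) \<noteq> 0" "\<And>\<sigma>. \<sigma> \<in> simplices K (Suc p) \<Longrightarrow>
      (\<Sum>\<tau>\<in>simplices K p. z \<tau> * Poly_Mapping.lookup (simplicial_boundary \<omega> (Suc p) (frag_of \<sigma>)) \<tau>) = 0"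
      by (rule ex_nonzero_cocycle) blast
    have "minor ?f n r c = 0"
    proof (rule minor_eq_0_if_left_kernel[OF n, of "\<lambda>i. z (r i)"])
      fix j assume j: "j < n"
      have "(\<Sum>i<n. z (r i) * ?f (r i) (c j)) = (\<Sum>\<tau>\<in>?I. z \<tau> * ?f \<tau> (c j))"
        by (simp add: sum.reindex[OF inj(1)])
      \<comment> \<open>The added terms vanish: a simplex with a nonzero coefficient in column
        \<open>c j\<close> lies in \<open>L\<close>, hence in \<open>?I\<close> by
        \<open>LI\<close>.\<close>
      also have "\<dots> = (\<Sum>\<tau>\<in>simplices K p. z \<tau> * ?f \<tau> (c j))"
        by (rule sum.mono_neutral_left[OF finite_simplices r]) (use face[OF _ j] LI in auto)
      also have "\<dots> = 0"
        using z(2)[of "c j"] c j by (auto simp: boundary_coeff_def)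
      finally show "(\<Sum>i<n. z (r i) * ?f (r i) (c j)) = 0" .
    qed (use z(1) in simp)
    then show False using D(1) by (simp add: D_def)
  qed
  define L0 where "L0 = generated_complex F0"
  have "finite F0" "\<forall>\<tau>\<in>F0. card \<tau> = Suc p"
    using L.finite_simplices by (auto simp: F0_def simplices_def)
  note gen_L0 = generated_complex_pure[OF this(1) \<open>F0 \<noteq> {}\<close> this(2), folded L0_def]
  have L0L: "L0 \<subseteq> L"
    using L.face_in_complex unfolding L0_def F0_def generated_complex_def simplices_def by blast
  interpret pair: oriented_pair L \<omega> L0
    using gen_L0(1) L0L by unfold_locales (auto simp: pure_complex_def)
  obtain g where g: "\<forall>i<n. \<forall>k<n. (\<Sum>j<n. ?f (r i) (c j) * g j k) = (if i = k then D else 0)"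
    unfolding D_def using ex_adjugate[of n ?f r c] by blast
  have "\<exists>x. \<forall>i<n. (\<Sum>j<n. ?f (r i) (c j) * x j) = (if i = k then 1 else 0)" if k: "k < n" for k
  proof -
    \<comment> \<open>Column \<open>k\<close> of the adjugate as a chain; the inverse of
      \<open>c\<close> translates a simplex back into its index.\<close>
    define e where "e = (\<Sum>\<sigma>\<in>?J. frag_cmul (g (the_inv_into {..<n} c \<sigma>) k) (frag_of \<sigma>))"
    have e: "Poly_Mapping.keys e \<subseteq> ?J"
      unfolding e_def by (rule frag_combination(2)) simp
    have reindex: "Poly_Mapping.lookup (simplicial_boundary \<omega> (Suc p) d) \<tau> =
        (\<Sum>j<n. ?f \<tau> (c j) * Poly_Mapping.lookup d (c j))"
      if "Poly_Mapping.keys d \<subseteq> ?J" for d \<tau>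
      using lookup_simplicial_boundary[OF _ that, of \<omega> "Suc p" \<tau>]
      by (simp add: sum.reindex[OF inj(2)])
    have row: "Poly_Mapping.lookup (simplicial_boundary \<omega> (Suc p) e) (r i) = (if i = k then D else 0)"
      if i: "i < n" for i
      unfolding reindex[OF e] using g i k
      by (simp add: e_def frag_combination(1) the_inv_into_f_f[OF inj(2)])
    have rk: "Poly_Mapping.keys (frag_of (r k)) \<subseteq> simplices L p"
      using rL k by auto
    \<comment> \<open>On \<open>?I\<close> the two chains agree by \<open>row\<close>, and both are
      supported on the \<open>p\<close>-simplices of \<open>L\<close>, so their difference lives on
      \<open>F0\<close>.\<close>
    have "Poly_Mapping.keys (frag_cmul D (frag_of (r k)) - simplicial_boundary \<omega> (Suc p) e) \<subseteq> simplices L0 p"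
    proof
      fix \<tau>
      assume \<tau>: "\<tau> \<in> Poly_Mapping.keys (frag_cmul D (frag_of (r k)) - simplicial_boundary \<omega> (Suc p) e)"
      have "\<tau> \<in> Poly_Mapping.keys (frag_of (r k)) \<union>
          Poly_Mapping.keys (simplicial_boundary \<omega> (Suc p) e)"
        using \<tau> keys_diff keys_cmul by (metis (no_types, lifting) Un_iff subsetD)
      then have "\<tau> \<in> simplices L p"
        using rk L.keys_boundary[of e p] e L(2) by blast
      moreover have "\<tau> \<notin> ?I"
      proof
        assume "\<tau> \<in> ?I"
        then obtain i where i: "i < n" "\<tau> = r i" by blast
        then have "r k = r i \<longleftrightarrow> i = k"
          using inj_on_eq_iff[OF inj(1), of k i] k by auto
        then show False
          using \<tau> row[OF i(1)] by (simp add: in_keys_iff lookup_minus i(2) split: if_splits)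
      qed
      ultimately show "\<tau> \<in> simplices L0 p"
        using gen_L0(2) by (simp add: F0_def)
    qed
    then obtain e' where e': "Poly_Mapping.keys e' \<subseteq> ?J"
        "Poly_Mapping.keys (frag_of (r k) - simplicial_boundary \<omega> (Suc p) e') \<subseteq> F0"
      using pair.torsion_free_rel_homology_iff[THEN iffD1, OF tf[OF gen_L0(1) L(1) L0L LK],
          rule_format, OF rk _ D(1), of e] e
      unfolding L(2) gen_L0(2) by blast
    have "(\<Sum>j<n. ?f (r i) (c j) * Poly_Mapping.lookup e' (c j)) = (if i = k then 1 else 0)"
      if i: "i < n" for i
    proof -
      have "r i \<notin> F0"
        using i unfolding F0_def by blast
      then have "r i \<notin> Poly_Mapping.keys (frag_of (r k) - simplicial_boundary \<omega> (Suc p) e')"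
        using e'(2) by blast
      then have "Poly_Mapping.lookup (frag_of (r k)) (r i) =
          Poly_Mapping.lookup (simplicial_boundary \<omega> (Suc p) e') (r i)"
        unfolding in_keys_iff lookup_minus by linarith
      moreover have "r i = r k \<longleftrightarrow> i = k"
        using inj_on_eq_iff[OF inj(1), of i k] k i by blast
      ultimately show ?thesis
        unfolding reindex[OF e'(1)] lookup_frag_of by presburger
    qed
    then show ?thesis
      by (intro exI[of _ "\<lambda>j. Poly_Mapping.lookup e' (c j)"]) simp
  qed
  then have "\<forall>k\<in>{..<n}. \<exists>x. \<forall>i<n. (\<Sum>j<n. ?f (r i) (c j) * x j) = (if i = k then 1 else 0)"
    by blast
  from bchoice[OF this] obtain x where
    x: "\<forall>k\<in>{..<n}. \<forall>i<n. (\<Sum>j<n. ?f (r i) (c j) * x k j) = (if i = k then 1 else 0)"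
    by blast
  have "D \<in> {-1, 1}"
    unfolding D_def by (rule minor_unit_if_surjective[of n _ _ _ x]) (rule x[rule_format]; simp)
  with D(2) show False by simp
qed

theorem theorem5p2:
  fixes K :: "'v set set" and p :: nat
    and \<omega> :: "'v set \<Rightarrow> 'v list"
    and faces cells :: "'v set list"
  assumes "finite_simplicial_complex K"
    and "complex_dim K > int p"
    and "orientation_of K \<omega>"
    and "distinct faces" and "set faces = simplices K p"
    and "distinct cells" and "set cells = simplices K (Suc p)"
  shows "totally_unimodular (boundary_matrix \<omega> (Suc p) faces cells) \<longleftrightarrow>
    (\<forall>L0 L. pure_complex p L0 \<longrightarrow> pure_complex (Suc p) L \<longrightarrow> L0 \<subseteq> L \<longrightarrow> L \<subseteq> K \<longrightarrow>
       torsion_free (rel_homology_group \<omega> L L0 p))"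
proof -
  interpret oriented_complex K \<omega>
    using assms(1,3) by unfold_locales
  have "totally_unimodular (boundary_matrix \<omega> (Suc p) faces cells) \<longleftrightarrow>
      minors_unimodular (simplices K p) (simplices K (Suc p)) (boundary_coeff \<omega> (Suc p))"
    using totally_unimodular_iff_minors_unimodular[of faces cells "boundary_coeff \<omega> (Suc p)"] assms(5,7)
    by (simp add: boundary_matrix_def boundary_coeff_def)
  also have "\<dots> \<longleftrightarrow> (\<forall>L0 L. pure_complex p L0 \<longrightarrow> pure_complex (Suc p) L \<longrightarrow> L0 \<subseteq> L \<longrightarrow> L \<subseteq> K \<longrightarrow>
       torsion_free (rel_homology_group \<omega> L L0 p))"
  proof (intro iffI allI impI)
    fix L0 L
    assume mu: "minors_unimodular (simplices K p) (simplices K (Suc p)) (boundary_coeff \<omega> (Suc p))"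
      and L: "pure_complex p L0" "pure_complex (Suc p) L" "L0 \<subseteq> L" "L \<subseteq> K"
    interpret oriented_pair L \<omega> L0
    proof
      show "finite_simplicial_complex L0" "finite_simplicial_complex L" "L0 \<subseteq> L"
        using L(1-3) unfolding pure_complex_def by blast+
      show "orientation_of L \<omega>"
        using \<omega> L(4) unfolding orientation_of_def by blast
    qed
    \<comment> \<open>The simplices of \<open>L\<close> are among those of \<open>K\<close> and the
      coefficients are the same, so every minor for \<open>L\<close> is a minor for
      \<open>K\<close>.\<close>
    show "torsion_free (rel_homology_group \<omega> L L0 p)"
      by (rule torsion_free_if_minors_unimodular, rule minors_unimodular_mono[OF mu])
        (use L(4) in \<open>auto simp: simplices_def\<close>)
  qed (rule minors_unimodular_if_torsion_free, blast)
  finally show ?thesis .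
qed

end
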